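(* Fix an absolute constant $C>0$ and let $q\in(0,1)$. There exist positive constants $c_1,C_2,c_2,c_3,c_4$, depending only on $q$ (and on the fixed absolute constant $C$), such that the following holds. Let $\mathbf{A}\in\mathbb{R}^{m\times n}$ have rows $\mathbf{a}_1,\dots,\mathbf{a}_m\in\mathbb{S}^{n-1}$ and satisfy $$\inf_{S\subseteq[m]:\,|S|\ge \frac q2 m}\sigma_{\min}(\mathbf{A}_S)\sqrt{\tfrac nm}\ \ge\ \frac{\sqrt{2\pi}\,(q/2)^{3/2}}{24},\qquad \frac{\sigma_{\max}(\mathbf{A})\sqrt n}{\sqrt m}\le C,$$ $$\frac{\sigma_{\max}(\mathbf{A})\sqrt n}{\sqrt m\,\sqrt{1-q'}}\le \frac{C}{\sqrt{1-q'}}\quad\text{for all } q'\in(0,1).$$ Let $\beta\in(0,c_1)$, let $\mathbf{b}=\mathbf{A}\mathbf{x}^*+\boldsymbol{\epsilon}$ with $\mathbf{x}^*\in\mathbb{R}^n$ and $\boldsymbol{\epsilon}\in\mathbb{R}^m$ an arbitrary $(\beta m)$-sparse vector, let $\mathbf{x}_0\in\mathbb{R}^n$, let $T>1$ be the (integer) number of iterations, and let $D$ be a positive integer with $$D\ge \frac{C_2\log T}{\log(1/\beta)}.$$ Let $\mathbf{X}_T$ be the iterate after $T$ steps of QuantileRK($q$) with subsample size $D$ started from $\mathbf{x}_0$. Then: (i) (Convergence in expectation) There exists a failure event $\Omega$ with $$\mathbb{P}(\Omega)\le T^{-5}\exp\Big(-\frac{1-q}{4}\log(1/\beta)\cdot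 D\Big)\le \frac12$$ such that $$\mathbb{E}\big(\|\mathbf{X}_T-\mathbf{x}^*\|^2\,1_{\Omega^c}\big)\le\Big(1-\frac{c_2}{n}\Big)^T\|\mathbf{x}_0-\mathbf{x}^*\|^2 .$$ (ii) (Convergence in probability) $$\mathbb{P}\Big(\|\mathbf{X}_T-\mathbf{x}^*\|^2\le\Big(1-\frac{c_3}{n}\Big)^T\|\mathbf{x}_0-\mathbf{x}^*\|^2\Big)\ge 1-T^{-5}-2\exp\Big(-\frac{c_4T}{n}\Big).$$
   Context: Notation: $[m]=\{1,\dots,m\}$; $\|\cdot\|$ is the Euclidean norm; $\log$ is the natural logarithm; $\mathbb{S}^{n-1}$ is the Euclidean unit sphere of $\mathbb{R}^n$; $\mathbf{A}_S$ is the submatrix of $\mathbf{A}$ with rows indexed by $S$; $\sigma_{\min}(\cdot)$ denotes the smallest nonzero singular value and $\sigma_{\max}(\cdot)$ the largest singular value of a matrix. A vector is $s$-sparse if it has at most $s$ nonzero entries (with arbitrary values). Quantile: for a multiset $\{z_1,\dots,z_N\}$ with nondecreasing rearrangement $z_1^*\le\dots\le z_N^*$, the $q$-quantile is $z^*_{\lfloor qN\rfloor}$ (and $z_1^*$ if $qN<1$). Algorithm QuantileRK($q$) with subsample size $D$ (rows of $\mathbf{A}$ have unit norm): start from the deterministic $\mathbf{X}_0=\mathbf{x}_0$. At step $k=0,1,\dots,T-1$, draw indices $i_1^{(k+1)},\dots,i_D^{(k+1)}$ (the quantile subsample) and $r_{k+1}$ (the update sample), all independent of one another and of the past and uniformly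 distributed on $[m]$. Put $h=\mathbf{a}_{r_{k+1}}^\top\mathbf{X}_k-b_{r_{k+1}}$. If $|h|$ is at most the $q$-quantile of the multiset $\{|\mathbf{a}_{i_j^{(k+1)}}^\top\mathbf{X}_k-b_{i_j^{(k+1)}}|\}_{j=1}^D$, set $\mathbf{X}_{k+1}=\mathbf{X}_k-h\,\mathbf{a}_{r_{k+1}}$; otherwise set $\mathbf{X}_{k+1}=\mathbf{X}_k$. The matrix $\mathbf{A}$, $\mathbf{x}^*$ and $\boldsymbol\epsilon$ are fixed; probability and expectation are over the algorithm's random samples. Standing convention: proportions of $m$ such as $qm$ and $\beta m$, and also $qD$, are assumed to be positive integers.
   Formalization: The formal theorem additionally assumes that every A_S with |S| ≥ (q/2)m has full column rank n; with σ_min the smallest nonzero singular value, the claim fails otherwise (A = identity, x_0 − x* = ε = e_1). *)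

theory Defs
  imports
    "HOL-Probability.Probability"
    "Jordan_Normal_Form.Spectral_Radius"
    "Jordan_Normal_Form.DL_Submatrix"
    "Jordan_Normal_Form.DL_Rank"
begin

text \<open>Dimensions have to be quantified inside formulas (constants must not depend on them), so
  matrices and vectors are those of \<^theory>\<open>Jordan_Normal_Form.Matrix\<close>, with row indices
  \<open>{..<m}\<close> in place of \<open>{1..m}\<close>. The symbols \<open>\<bullet>\<close> and \<open>$\<close> are used for these only.\<close>

unbundle no inner_syntax
unbundle no vec_syntax

definition euclid_norm :: "real Matrix.vec \<Rightarrow> real" where
  "euclid_norm v = sqrt (v \<bullet> v)"

definition singular_values :: "real mat \<Rightarrow> real set" where
  "singular_values A = sqrt ` spectrum (A\<^sup>T * A)"

definition sigma_max :: "real mat \<Rightarrow> real" where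
  "sigma_max A = Max (singular_values A)"

text \<open>The smallest \<^emph>\<open>nonzero\<close> singular value: it is positive for every nonzero matrix, also for
  one without full column rank. A lower bound on it controls \<open>A *\<^sub>v x\<close> for all \<open>x\<close> only together
  with a full rank assumption, which is therefore stated separately where it is needed.\<close>

definition sigma_min :: "real mat \<Rightarrow> real" where
  "sigma_min A = Min (singular_values A - {0})"

definition row_submatrix :: "real mat \<Rightarrow> nat set \<Rightarrow> real mat" where
  "row_submatrix A S = submatrix A S UNIV"

definition sparse_vec :: "real \<Rightarrow> real Matrix.vec \<Rightarrow> bool" where
  "sparse_vec s v \<longleftrightarrow> real (card {i. i < dim_vec v \<and> v $ i \<noteq> 0}) \<le> s"

text \<open>The list below is indexed from 0, so \<open>z\<^sub>k\<^sup>*\<close> is its entry \<open>k - 1\<close>.\<close>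

definition quantile :: "real \<Rightarrow> real multiset \<Rightarrow> real" where
  "quantile q Z = sorted_list_of_multiset Z ! (max 1 (nat \<lfloor>q * real (size Z)\<rfloor>) - 1)"

definition residual :: "real mat \<Rightarrow> real Matrix.vec \<Rightarrow> real Matrix.vec \<Rightarrow> nat \<Rightarrow> real" where
  "residual A b x i = Matrix.row A i \<bullet> x - b $ i"

text \<open>The draws of one step are a pair \<open>(i, r)\<close>: the quantile subsample \<open>i 0, \<dots>, i (D - 1)\<close> and the
  update index \<open>r\<close>.\<close>

definition quantileRK_step ::
  "real \<Rightarrow> nat \<Rightarrow> real mat \<Rightarrow> real Matrix.vec \<Rightarrow> (nat \<Rightarrow> nat) \<times> nat \<Rightarrow> real Matrix.vec \<Rightarrow> real Matrix.vec"
where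
  "quantileRK_step q D A b = (\<lambda>(i, r) x.
     let h = residual A b x r in
     if \<bar>h\<bar> \<le> quantile q (image_mset (\<lambda>j. \<bar>residual A b x (i j)\<bar>) (mset_set {..<D}))
     then x - h \<cdot>\<^sub>v Matrix.row A r else x)"

primrec quantileRK ::
  "real \<Rightarrow> nat \<Rightarrow> real mat \<Rightarrow> real Matrix.vec \<Rightarrow> real Matrix.vec \<Rightarrow> (nat \<Rightarrow> (nat \<Rightarrow> nat) \<times> nat) \<Rightarrow> nat
    \<Rightarrow> real Matrix.vec"
where
  "quantileRK q D A b x0 \<omega> 0 = x0"
| "quantileRK q D A b x0 \<omega> (Suc k) = quantileRK_step q D A b (\<omega> k) (quantileRK q D A b x0 \<omega> k)"

text \<open>All \<open>T * (D + 1)\<close> draws of \<open>T\<close> steps, independent and uniform on \<open>{..<m}\<close>. The values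
  \<open>0\<close> and \<open>undefined\<close> are only fillers outside the finite index sets.\<close>

definition draws_pmf :: "nat \<Rightarrow> nat \<Rightarrow> nat \<Rightarrow> (nat \<Rightarrow> (nat \<Rightarrow> nat) \<times> nat) pmf" where
  "draws_pmf m D T = Pi_pmf {..<T} undefined
     (\<lambda>_. pair_pmf (Pi_pmf {..<D} 0 (\<lambda>_. pmf_of_set {..<m})) (pmf_of_set {..<m}))"

end

theory Submission
  imports Defs
begin

text \<open>Let \<open>e = X\<^sub>k - x\<^sup>*\<close>. Call a step moderate if its subsample quantile is at most
  \<open>C \<beta>\<^bsup>-1/4\<^esup> \<parallel>e\<parallel> / sqrt n\<close>. The bound on the largest singular value leaves only a fraction
  \<open>2 sqrt \<beta>\<close> of residuals above this level, so a step fails to be moderate with probability at most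
  \<open>2\<^sup>D (2 sqrt \<beta>)\<^bsup>(1-q)D\<^esup>\<close>, and a union bound over the \<open>T\<close> steps controls the failure event.

  In a moderate step the corrupted rows raise the mean of \<open>\<parallel>e\<parallel>\<^sup>2\<close> by at most
  \<open>3 C\<^sup>2 \<beta>\<^bsup>1/4\<^esup> \<parallel>e\<parallel>\<^sup>2 / n\<close>. Progress needs the quantile not to be too small either, which can fail with
  a probability that does not vanish as \<open>\<beta>\<close> tends to \<open>0\<close>; this is why that failure is not put into
  \<open>\<Omega>\<close>. By Markov's inequality at least a fraction \<open>3q/4\<close> of the rows is accepted with
  probability at least \<open>1/4\<close>. Then the uncorrupted accepted rows number at least \<open>q m / 2\<close>, and the
  bound on smallest singular values gives a decrease by \<open>a\<^sup>2 \<parallel>e\<parallel>\<^sup>2 / n\<close>. Averaging yields a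
  contraction of the mean, and Markov's inequality turns it into the bound in probability.\<close>

section \<open>Singular values and quadratic forms\<close>

text \<open>A nonnegative quadratic that vanishes at 0 has its minimum there, so its slope is 0.
  This serves as the first-order condition at a minimiser of the Rayleigh quotient.\<close>

lemma linear_coeff_zero:
  fixes a c :: real
  assumes "\<And>t. 0 \<le> 2 * t * a + t\<^sup>2 * c"
  shows "a = 0"
proof (rule ccontr)
  assume a: "a \<noteq> 0"
  define d where "d = \<bar>c\<bar> + 1"
  have d: "d > 0" "c < d" unfolding d_def by auto
  have "0 \<le> 2 * (- a / d) * a + (- a / d)\<^sup>2 * c" by (rule assms)
  also have "\<dots> = a\<^sup>2 / d * (c / d - 2)"
    using d by (simp add: field_simps power2_eq_square)
  also have "\<dots> < 0"
    using a d by (intro mult_pos_neg) (auto simp: field_simps)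
  finally show False by simp
qed

lemma scalar_prod_self_nonneg: "(0::real) \<le> x \<bullet> x"
  unfolding scalar_prod_def by (intro sum_nonneg) auto

lemma scalar_prod_self_eq_0:
  fixes x :: "real Matrix.vec"
  assumes "x \<in> carrier_vec n" "x \<bullet> x = 0"
  shows "x = 0\<^sub>v n"
proof -
  have "\<forall>i\<in>{0..<n}. x $ i * x $ i = 0"
    using assms by (subst sum_nonneg_eq_0_iff[symmetric]) (auto simp: scalar_prod_def)
  then show ?thesis using assms(1) by (intro eq_vecI) auto
qed

lemma scalar_prod_mult_mat_vec_sum:
  fixes M :: "real mat"
  assumes "M \<in> carrier_mat n n"
  shows "Matrix.vec n f \<bullet> (M *\<^sub>v Matrix.vec n f) = (\<Sum>i<n. \<Sum>j<n. f i * M $$ (i, j) * f j)"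
  using assms
  by (auto simp: scalar_prod_def sum_distrib_left mult_mat_vec_def atLeast0LessThan mult.assoc intro!: sum.cong)

lemma vec_scalar_prod_self: "Matrix.vec n f \<bullet> Matrix.vec n f = (\<Sum>i<n. (f i :: real)\<^sup>2)"
  by (auto simp: scalar_prod_def atLeast0LessThan power2_eq_square)

text \<open>The dimension \<open>n\<close> is a variable, so compactness is taken from the product topology on
  \<open>nat \<Rightarrow> real\<close>, with the coordinates beyond \<open>n\<close> frozen at \<open>0\<close>.\<close>

lemma rayleigh_min_exists:
  fixes M :: "real mat"
  assumes M: "M \<in> carrier_mat n n" and n: "n > 0"
  shows "\<exists>v\<in>carrier_vec n. v \<bullet> v = 1 \<and> (\<forall>x\<in>carrier_vec n. (v \<bullet> (M *\<^sub>v v)) * (x \<bullet> x) \<le> x \<bullet> (M *\<^sub>v x))"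
proof -
  define quad where "quad f = (\<Sum>i<n. \<Sum>j<n. f i * M $$ (i, j) * f j)" for f :: "nat \<Rightarrow> real"
  define nrm where "nrm f = (\<Sum>i<n. (f i)\<^sup>2)" for f :: "nat \<Rightarrow> real"
  define B :: "nat \<Rightarrow> real set" where "B i = (if i < n then {-1..1} else {0})" for i
  have "compactin (product_topology (\<lambda>_. euclidean) UNIV) (PiE UNIV B)"
    unfolding compactin_PiE by (auto simp: B_def)
  then have K: "compact (PiE UNIV B)"
    by (simp add: euclidean_product_topology)
  have cn: "continuous_on UNIV nrm" and cq: "continuous_on UNIV quad"
    unfolding nrm_def quad_def
    by (intro continuous_intros continuous_on_product_coordinates)+
  have "closed {f. nrm f = 1}"
    using continuous_closed_preimage_constant[OF cn, of 1] by simp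
  with K have comp: "compact (PiE UNIV B \<inter> {f. nrm f = 1})" by (rule compact_Int_closed)
  have "(\<lambda>i. if i = 0 then 1 else 0) \<in> PiE UNIV B \<inter> {f. nrm f = 1}"
    using n by (auto simp: B_def nrm_def if_distrib[of "\<lambda>x. x\<^sup>2"] cong: if_cong)
  then have ne: "PiE UNIV B \<inter> {f. nrm f = 1} \<noteq> {}" by blast
  obtain f where f: "f \<in> PiE UNIV B" "nrm f = 1"
    and fmin: "\<And>g. g \<in> PiE UNIV B \<Longrightarrow> nrm g = 1 \<Longrightarrow> quad f \<le> quad g"
    using continuous_attains_inf[OF comp ne continuous_on_subset[OF cq]] by auto
  \<comment> \<open>Both sides are homogeneous of degree 2, so the bound on unit vectors extends by
    rescaling; \<open>h\<close> is cut off beyond \<open>n\<close> to stay in the compact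
    set.\<close>
  have min: "quad f * nrm g \<le> quad g" for g
  proof (cases "nrm g = 0")
    case True
    then have "\<forall>i\<in>{..<n}. (g i)\<^sup>2 = 0"
      unfolding nrm_def by (subst sum_nonneg_eq_0_iff[symmetric]) auto
    then have "quad g = 0" by (simp add: quad_def)
    with True show ?thesis by simp
  next
    case False
    then have pos: "nrm g > 0"
      by (metis nrm_def order_less_le sum_nonneg zero_le_power2)
    define s where "s = sqrt (nrm g)"
    have s: "s > 0" "s\<^sup>2 = nrm g" using pos by (auto simp: s_def)
    define h where "h i = (if i < n then g i / s else 0)" for i
    have nh: "nrm h = 1"
    proof -
      have "nrm h = (\<Sum>i<n. (g i)\<^sup>2 / s\<^sup>2)"
        unfolding nrm_def h_def by (intro sum.cong) (auto simp: power_divide)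
      also have "\<dots> = nrm g / s\<^sup>2" by (simp add: nrm_def sum_divide_distrib)
      finally show ?thesis using s pos by simp
    qed
    have "h i \<in> B i" for i
    proof (cases "i < n")
      case True
      have "(h i)\<^sup>2 \<le> nrm h"
        unfolding nrm_def using True by (intro member_le_sum) auto
      then show ?thesis using True nh by (auto simp: B_def abs_square_le_1 abs_le_iff)
    qed (auto simp: B_def h_def)
    then have "quad f \<le> quad h" using nh by (intro fmin) auto
    also have "quad h = (\<Sum>i<n. \<Sum>j<n. g i * M $$ (i, j) * g j / s\<^sup>2)"
      unfolding quad_def h_def by (intro sum.cong) (auto simp: power2_eq_square)
    also have "\<dots> = quad g / s\<^sup>2" by (simp add: quad_def sum_divide_distrib)
    finally show ?thesis using s pos by (simp add: field_simps)
  qed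
  show ?thesis
  proof (intro bexI[of _ "Matrix.vec n f"] conjI ballI)
    show "Matrix.vec n f \<bullet> Matrix.vec n f = 1" using f(2) by (simp add: vec_scalar_prod_self nrm_def)
    fix x :: "real Matrix.vec"
    assume "x \<in> carrier_vec n"
    then have x: "x = Matrix.vec n (\<lambda>i. x $ i)" by auto
    show "Matrix.vec n f \<bullet> (M *\<^sub>v Matrix.vec n f) * (x \<bullet> x) \<le> x \<bullet> (M *\<^sub>v x)"
      using min[of "\<lambda>i. x $ i"]
      by (subst x, subst (2) x, subst (2) x, subst (2) x)
        (simp only: scalar_prod_mult_mat_vec_sum[OF M] vec_scalar_prod_self quad_def nrm_def)
  qed auto
qed

text \<open>A unit minimiser \<open>v\<close> of the Rayleigh quotient is an eigenvector, because
  the first variation makes every \<open>y\<close> orthogonal to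
  \<open>M *\<^sub>v v - l \<cdot>\<^sub>v v\<close>. So the minimum \<open>l\<close> is itself an
  eigenvalue.\<close>

lemma spectrum_lower_bound:
  fixes M :: "real mat"
  assumes M: "M \<in> carrier_mat n n" and sym: "M\<^sup>T = M" and n: "n > 0"
  shows "\<exists>l\<in>spectrum M. \<forall>x\<in>carrier_vec n. l * (x \<bullet> x) \<le> x \<bullet> (M *\<^sub>v x)"
proof -
  obtain v where v: "v \<in> carrier_vec n" "v \<bullet> v = 1"
    and min: "\<And>x. x \<in> carrier_vec n \<Longrightarrow> (v \<bullet> (M *\<^sub>v v)) * (x \<bullet> x) \<le> x \<bullet> (M *\<^sub>v x)"
    using rayleigh_min_exists[OF M n] by blast
  define l where "l = v \<bullet> (M *\<^sub>v v)"
  have Mv: "M *\<^sub>v v \<in> carrier_vec n" using M v by auto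
  have crit: "y \<bullet> (M *\<^sub>v v) - l * (y \<bullet> v) = 0" if y: "y \<in> carrier_vec n" for y
  proof (rule linear_coeff_zero)
    fix t :: real
    have My: "M *\<^sub>v y \<in> carrier_vec n" using M y by auto
    have symm: "v \<bullet> (M *\<^sub>v y) = y \<bullet> (M *\<^sub>v v)"
      using transpose_vec_mult_scalar[OF M v(1) y] sym M v y Mv by (simp add: comm_scalar_prod[of _ n])
    have vy: "v \<bullet> y = y \<bullet> v" using v y by (simp add: comm_scalar_prod[of _ n])
    have "l * ((v + t \<cdot>\<^sub>v y) \<bullet> (v + t \<cdot>\<^sub>v y)) \<le> (v + t \<cdot>\<^sub>v y) \<bullet> (M *\<^sub>v (v + t \<cdot>\<^sub>v y))"
      unfolding l_def using v y by (intro min) auto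
    moreover have "(v + t \<cdot>\<^sub>v y) \<bullet> (v + t \<cdot>\<^sub>v y) = 1 + 2 * t * (y \<bullet> v) + t\<^sup>2 * (y \<bullet> y)"
      using v y vy by (simp add: add_scalar_prod_distrib[of _ n] scalar_prod_add_distrib[of _ n]
          power2_eq_square algebra_simps)
    moreover have "M *\<^sub>v (v + t \<cdot>\<^sub>v y) = M *\<^sub>v v + t \<cdot>\<^sub>v (M *\<^sub>v y)"
      using M v y by (simp add: mult_add_distrib_mat_vec[OF M] mult_mat_vec[OF M])
    then have "(v + t \<cdot>\<^sub>v y) \<bullet> (M *\<^sub>v (v + t \<cdot>\<^sub>v y)) =
        l + 2 * t * (y \<bullet> (M *\<^sub>v v)) + t\<^sup>2 * (y \<bullet> (M *\<^sub>v y))"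
      using v y symm My Mv by (simp add: add_scalar_prod_distrib[of _ n] scalar_prod_add_distrib[of _ n]
          power2_eq_square algebra_simps l_def)
    ultimately show "0 \<le> 2 * t * (y \<bullet> (M *\<^sub>v v) - l * (y \<bullet> v)) + t\<^sup>2 * (y \<bullet> (M *\<^sub>v y) - l * (y \<bullet> y))"
      by (simp add: algebra_simps)
  qed
  \<comment> \<open>The variation in the direction of the eigenvector defect itself gives
    \<open>d \<bullet> d = 0\<close>.\<close>
  define d where "d = M *\<^sub>v v - l \<cdot>\<^sub>v v"
  have d: "d \<in> carrier_vec n" using Mv v by (auto simp: d_def)
  have "d \<bullet> d = d \<bullet> (M *\<^sub>v v) - l * (d \<bullet> v)"
    using d Mv v by (subst (2) d_def) (simp add: scalar_prod_minus_distrib[of _ n])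
  with crit[OF d] have d0: "d = 0\<^sub>v n" using d by (intro scalar_prod_self_eq_0) auto
  have "M *\<^sub>v v = l \<cdot>\<^sub>v v"
  proof (rule eq_vecI)
    fix i assume "i < dim_vec (l \<cdot>\<^sub>v v)"
    then have i: "i < n" using v by simp
    have "d $ i = 0" using d0 i by simp
    then show "(M *\<^sub>v v) $ i = (l \<cdot>\<^sub>v v) $ i"
      using i v Mv unfolding d_def by (subst (asm) index_minus_vec) auto
  qed (use M v in auto)
  moreover have "v \<noteq> 0\<^sub>v n" using v by auto
  ultimately have "l \<in> spectrum M"
    using v M by (auto simp: spectrum_def eigenvalue_def eigenvector_def)
  then show ?thesis using min unfolding l_def by blast
qed

text \<open>Passing to \<open>- M\<close> exchanges minima and maxima of the form and negates the
  eigenvalues.\<close>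

lemma spectrum_upper_bound:
  fixes M :: "real mat"
  assumes M: "M \<in> carrier_mat n n" and sym: "M\<^sup>T = M" and n: "n > 0"
  shows "\<exists>l\<in>spectrum M. \<forall>x\<in>carrier_vec n. x \<bullet> (M *\<^sub>v x) \<le> l * (x \<bullet> x)"
proof -
  have neg: "- M *\<^sub>v x = - (M *\<^sub>v x)" if "x \<in> carrier_vec n" for x
    using M that by (intro eq_vecI) auto
  have "(- M)\<^sup>T = - M" using sym M by (metis transpose_uminus)
  then obtain l where l: "l \<in> spectrum (- M)"
    and min: "\<And>x. x \<in> carrier_vec n \<Longrightarrow> l * (x \<bullet> x) \<le> x \<bullet> (- M *\<^sub>v x)"
    using spectrum_lower_bound[of "- M" n] M n by auto
  from l obtain v where v: "v \<in> carrier_vec n" "v \<noteq> 0\<^sub>v n" "- M *\<^sub>v v = l \<cdot>\<^sub>v v"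
    using M by (auto simp: spectrum_def eigenvalue_def eigenvector_def)
  have "M *\<^sub>v v = - (- M *\<^sub>v v)" using M v(1) by (simp add: neg)
  also have "\<dots> = (- l) \<cdot>\<^sub>v v" unfolding v(3) by (intro eq_vecI) auto
  finally have "- l \<in> spectrum M"
    using v M by (auto simp: spectrum_def eigenvalue_def eigenvector_def)
  moreover have "x \<bullet> (M *\<^sub>v x) \<le> - l * (x \<bullet> x)" if x: "x \<in> carrier_vec n" for x
    using min[OF x] M x by (simp add: neg)
  ultimately show ?thesis by blast
qed

section \<open>Extreme singular values as bounds on the Gram form\<close>

lemma gram_carrier_sym:
  fixes A :: "real mat"
  assumes A: "A \<in> carrier_mat m n"
  shows "A\<^sup>T * A \<in> carrier_mat n n" and "(A\<^sup>T * A)\<^sup>T = A\<^sup>T * A"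
  using A by (auto simp: transpose_mult[of _ n m])

lemma gram_quadratic_form:
  fixes A :: "real mat"
  assumes A: "A \<in> carrier_mat m n" and x: "x \<in> carrier_vec n"
  shows "x \<bullet> (A\<^sup>T * A *\<^sub>v x) = (A *\<^sub>v x) \<bullet> (A *\<^sub>v x)"
proof -
  have y: "A *\<^sub>v x \<in> carrier_vec m" using A x by auto
  have "x \<bullet> (A\<^sup>T * A *\<^sub>v x) = x \<bullet> (A\<^sup>T *\<^sub>v (A *\<^sub>v x))"
    using A x by (subst assoc_mult_mat_vec) auto
  also have "\<dots> = (A\<^sup>T *\<^sub>v (A *\<^sub>v x)) \<bullet> x"
    using A x y by (simp add: comm_scalar_prod[of _ n])
  also have "\<dots> = (A *\<^sub>v x) \<bullet> (A *\<^sub>v x)" by (rule transpose_vec_mult_scalar[OF A x y])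
  finally show ?thesis .
qed

lemma finite_singular_values:
  assumes "A \<in> carrier_mat m n"
  shows "finite (singular_values A)"
  using card_finite_spectrum(1)[OF gram_carrier_sym(1)[OF assms]] by (simp add: singular_values_def)

text \<open>The Gram form is dominated by one of its eigenvalues, whose square root is among the
  singular values and hence at most their maximum.\<close>

lemma sigma_max_bound:
  assumes A: "A \<in> carrier_mat m n" and n: "n > 0" and x: "x \<in> carrier_vec n"
  shows "(A *\<^sub>v x) \<bullet> (A *\<^sub>v x) \<le> (sigma_max A)\<^sup>2 * (x \<bullet> x)"
proof -
  obtain l where l: "l \<in> spectrum (A\<^sup>T * A)"
    and le: "x \<bullet> (A\<^sup>T * A *\<^sub>v x) \<le> l * (x \<bullet> x)"
    using spectrum_upper_bound[OF gram_carrier_sym[OF A] n] x by blast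
  have s: "sqrt l \<le> sigma_max A"
    unfolding sigma_max_def using finite_singular_values[OF A] l by (auto simp: singular_values_def)
  \<comment> \<open>The sign of \<open>l\<close> has not been established here; for negative
    \<open>l\<close> the bound is trivial.\<close>
  have "l \<le> (sigma_max A)\<^sup>2"
  proof (cases "l \<ge> 0")
    case True
    then show ?thesis using s power_mono[OF s, of 2] by simp
  qed (use zero_le_power2[of "sigma_max A"] in linarith)
  then have "l * (x \<bullet> x) \<le> (sigma_max A)\<^sup>2 * (x \<bullet> x)"
    by (intro mult_right_mono scalar_prod_self_nonneg)
  with le show ?thesis by (simp add: gram_quadratic_form[OF A x])
qed

text \<open>A unit vector shows that the dominating eigenvalue is nonnegative. The sign allows an
  upper bound on \<open>sigma_max\<close> to be squared.\<close>

lemma sigma_max_nonneg: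
  assumes A: "A \<in> carrier_mat m n" and n: "n > 0"
  shows "0 \<le> sigma_max A"
proof -
  obtain l where l: "l \<in> spectrum (A\<^sup>T * A)"
    and le: "\<And>x. x \<in> carrier_vec n \<Longrightarrow> x \<bullet> (A\<^sup>T * A *\<^sub>v x) \<le> l * (x \<bullet> x)"
    using spectrum_upper_bound[OF gram_carrier_sym[OF A] n] by blast
  have u: "unit_vec n 0 \<in> carrier_vec n" "unit_vec n 0 \<bullet> unit_vec n 0 = (1::real)"
    using n by auto
  have "0 \<le> l"
    using le[OF u(1)] scalar_prod_self_nonneg[of "A *\<^sub>v unit_vec n 0"] u
    by (simp add: gram_quadratic_form[OF A u(1)] del: scalar_prod_left_unit scalar_prod_right_unit)
  then have "0 \<le> sqrt l" by simp
  also have "sqrt l \<le> sigma_max A"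
    unfolding sigma_max_def using finite_singular_values[OF A] l by (auto simp: singular_values_def)
  finally show ?thesis .
qed

text \<open>Injectivity makes every eigenvalue of the Gram matrix positive, so discarding 0 in
  \<open>sigma_min\<close> removes nothing, and the eigenvalue that minimises the Rayleigh quotient
  takes part in the minimum.\<close>

lemma sigma_min_bound:
  assumes A: "A \<in> carrier_mat m n" and n: "n > 0" and x: "x \<in> carrier_vec n"
    and inj: "\<And>v. v \<in> carrier_vec n \<Longrightarrow> A *\<^sub>v v = 0\<^sub>v m \<Longrightarrow> v = 0\<^sub>v n"
  shows "0 \<le> sigma_min A" and "(sigma_min A)\<^sup>2 * (x \<bullet> x) \<le> (A *\<^sub>v x) \<bullet> (A *\<^sub>v x)"
proof -
  have pos: "l > 0" if l: "l \<in> spectrum (A\<^sup>T * A)" for l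
  proof -
    obtain v where v: "v \<in> carrier_vec n" "v \<noteq> 0\<^sub>v n" "A\<^sup>T * A *\<^sub>v v = l \<cdot>\<^sub>v v"
      using A l by (auto simp: spectrum_def eigenvalue_def eigenvector_def simp del: assoc_mult_mat_vec)
    have "l * (v \<bullet> v) = (A *\<^sub>v v) \<bullet> (A *\<^sub>v v)"
      using gram_quadratic_form[OF A v(1)] v by simp
    moreover have "v \<bullet> v > 0"
      using scalar_prod_self_nonneg[of v] scalar_prod_self_eq_0[OF v(1)] v(2) by fastforce
    moreover have "(A *\<^sub>v v) \<bullet> (A *\<^sub>v v) > 0"
      using scalar_prod_self_nonneg[of "A *\<^sub>v v"] scalar_prod_self_eq_0[of "A *\<^sub>v v" m] inj[OF v(1)] v(1,2) A
      by fastforce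
    ultimately show ?thesis by (metis zero_less_mult_pos2)
  qed
  obtain l where l: "l \<in> spectrum (A\<^sup>T * A)" and le: "l * (x \<bullet> x) \<le> x \<bullet> (A\<^sup>T * A *\<^sub>v x)"
    using spectrum_lower_bound[OF gram_carrier_sym[OF A] n] x by blast
  have mem: "sqrt l \<in> singular_values A - {0}"
    using l pos[OF l] by (auto simp: singular_values_def)
  have fin: "finite (singular_values A - {0})" using finite_singular_values[OF A] by simp
  have s: "sigma_min A \<le> sqrt l" unfolding sigma_min_def using fin mem by (rule Min_le)
  have "sigma_min A \<in> singular_values A - {0}"
    unfolding sigma_min_def using fin mem by (intro Min_in) auto
  then show s0: "0 \<le> sigma_min A" using pos by (force simp: singular_values_def)
  have "(sigma_min A)\<^sup>2 \<le> l" using power_mono[OF s s0, of 2] pos[OF l] by simp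
  then have "(sigma_min A)\<^sup>2 * (x \<bullet> x) \<le> l * (x \<bullet> x)"
    by (intro mult_right_mono scalar_prod_self_nonneg)
  with le show "(sigma_min A)\<^sup>2 * (x \<bullet> x) \<le> (A *\<^sub>v x) \<bullet> (A *\<^sub>v x)"
    by (simp add: gram_quadratic_form[OF A x])
qed

text \<open>The rank counts independent vectors in the set of columns, so a repeated column would
  push it below \<open>nc\<close>.\<close>

lemma (in vec_space) full_rank_distinct_cols:
  assumes A: "A \<in> carrier_mat n nc" and r: "rank A = nc"
  shows "distinct (cols A)"
proof -
  obtain S where S: "maximal S (\<lambda>T. T \<subseteq> set (cols A) \<and> lin_indpt T)"
    using maximal_exists_superset[of "set (cols A)" "\<lambda>T. T \<subseteq> set (cols A) \<and> lin_indpt T" "{}"]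
    by (auto simp: finite_lin_indpt2)
  have "nc = card S" using rank_card_indpt[OF A S] r by simp
  also have "\<dots> \<le> card (set (cols A))"
    using S by (intro card_mono) (auto simp: maximal_def)
  finally show ?thesis
    using A card_length[of "cols A"] by (intro card_distinct) auto
qed

text \<open>A nonzero kernel vector is a linear dependence among the columns. This turns the rank
  hypothesis into the injectivity that \<open>sigma_min_bound\<close> asks for.\<close>

lemma (in vec_space) full_rank_kernel:
  assumes A: "A \<in> carrier_mat n nc" and r: "rank A = nc"
    and v: "v \<in> carrier_vec nc" "A *\<^sub>v v = 0\<^sub>v n"
  shows "v = 0\<^sub>v nc"
  using lin_depI[OF A v(1) _ v(2) full_rank_distinct_cols[OF A r]]
    full_rank_lin_indpt[OF A r full_rank_distinct_cols[OF A r]] by blast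

section \<open>Row submatrices and sums of squares over rows\<close>

lemma bij_betw_pick:
  assumes "finite S"
  shows "bij_betw (pick S) {..<card S} S"
proof -
  have inj: "inj_on (pick S) {..<card S}"
    by (intro inj_onI) (use pick_mono_le in \<open>metis lessThan_iff linorder_neqE_nat order_less_irrefl\<close>)
  have sub: "pick S ` {..<card S} \<subseteq> S"
    using pick_in_set_le by auto
  have "pick S ` {..<card S} = S"
    by (intro card_subset_eq assms sub) (simp add: card_image inj)
  with inj show ?thesis by (simp add: bij_betw_def)
qed

lemma row_submatrix_carrier:
  assumes "A \<in> carrier_mat m n" "S \<subseteq> {..<m}"
  shows "row_submatrix A S \<in> carrier_mat (card S) n"
proof -
  have "{i. i < m \<and> i \<in> S} = S" using assms by auto
  then show ?thesis
    using assms by (auto simp: row_submatrix_def submatrix_def)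
qed

lemma row_submatrix_norm:
  fixes A :: "real mat"
  assumes A: "A \<in> carrier_mat m n" and S: "S \<subseteq> {..<m}" and x: "x \<in> carrier_vec n"
  shows "(row_submatrix A S *\<^sub>v x) \<bullet> (row_submatrix A S *\<^sub>v x) = (\<Sum>i\<in>S. (Matrix.row A i \<bullet> x)\<^sup>2)"
proof -
  have fin: "finite S" using S finite_subset by blast
  have eq: "{i. i < m \<and> i \<in> S} = S" using S by auto
  have row: "Matrix.row (row_submatrix A S) k = Matrix.row A (pick S k)" if k: "k < card S" for k
  proof -
    have "pick S k < m" using pick_in_set_le[OF k] S by auto
    then show ?thesis
      using A k by (intro eq_vecI) (auto simp: row_submatrix_def submatrix_def eq pick_UNIV)
  qed
  have "(row_submatrix A S *\<^sub>v x) \<bullet> (row_submatrix A S *\<^sub>v x)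
      = (\<Sum>k<card S. (Matrix.row A (pick S k) \<bullet> x)\<^sup>2)"
    using row_submatrix_carrier[OF A S]
    by (auto simp: scalar_prod_def[of "_ *\<^sub>v _"] atLeast0LessThan power2_eq_square row intro!: sum.cong)
  also have "\<dots> = (\<Sum>i\<in>S. (Matrix.row A i \<bullet> x)\<^sup>2)"
    by (rule sum.reindex_bij_betw[OF bij_betw_pick[OF fin]])
  finally show ?thesis .
qed

lemma mult_mat_vec_norm:
  fixes A :: "real mat"
  assumes A: "A \<in> carrier_mat m n"
  shows "(A *\<^sub>v x) \<bullet> (A *\<^sub>v x) = (\<Sum>i<m. (Matrix.row A i \<bullet> x)\<^sup>2)"
  using A by (auto simp: scalar_prod_def[of "_ *\<^sub>v _"] atLeast0LessThan power2_eq_square intro!: sum.cong)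

section \<open>Quantiles\<close>

lemma card_filter_nth_mset:
  "card {i. i < length l \<and> P (l ! i)} = size (filter_mset P (mset l))"
  by (metis length_filter_conv_card mset_filter size_mset)

lemma size_filter_image_mset_set:
  "finite A \<Longrightarrow> size (filter_mset P (image_mset f (mset_set A))) = card {a \<in> A. P (f a)}"
  by (simp add: filter_mset_image_mset)

lemma quantile_index_bounds:
  assumes q: "0 < q" "q < 1" and D: "D > 0" and k: "q * real D = real k"
  shows "0 < k" and "k \<le> D"
proof -
  have "0 < q * real D" using q D by simp
  then show "0 < k" using k by simp
  have "q * real D \<le> 1 * real D" using q by (intro mult_right_mono) auto
  then show "k \<le> D" using k by simp
qed

text \<open>In the zero-based sorted list the quantile sits at position \<open>k - 1\<close>, and it
  and all later entries exceed \<open>t\<close>. The bound \<open>D - k\<close> is one less than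
  their number; it equals \<open>(1 - q) * D\<close>, the exponent in the union bound.\<close>

lemma quantile_greater_card:
  fixes z :: "nat \<Rightarrow> real"
  assumes D: "D > 0" and k: "q * real D = real k" "0 < k" "k \<le> D"
    and gt: "quantile q (image_mset z (mset_set {..<D})) > t"
  shows "card {j. j < D \<and> z j > t} \<ge> D - k"
proof -
  define l where "l = sorted_list_of_multiset (image_mset z (mset_set {..<D}))"
  have ml: "mset l = image_mset z (mset_set {..<D})" by (simp add: l_def)
  have len: "length l = D" by (simp flip: size_mset add: ml)
  have gt': "l ! (k - 1) > t"
    using gt k by (simp add: quantile_def l_def max_def)
  have "{k - 1..<D} \<subseteq> {i. i < length l \<and> l ! i > t}"
  proof safe
    fix i assume "i \<in> {k - 1..<D}"
    moreover have "sorted l" by (simp add: l_def)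
    ultimately have "l ! (k - 1) \<le> l ! i" using len by (intro sorted_nth_mono) auto
    then show "t < l ! i" using gt' by simp
  qed (simp add: len)
  then have "card {k - 1..<D} \<le> card {i. i < length l \<and> l ! i > t}"
    by (intro card_mono) auto
  also have "\<dots> = card {j \<in> {..<D}. z j > t}"
    unfolding card_filter_nth_mset[of l "\<lambda>x. x > t"] ml by (simp add: size_filter_image_mset_set)
  finally show ?thesis by simp
qed

text \<open>The entry at position \<open>k - 1\<close> and the \<open>k - 1\<close> entries before
  it are all below \<open>t\<close>.\<close>

lemma quantile_less_card:
  fixes z :: "nat \<Rightarrow> real"
  assumes D: "D > 0" and k: "q * real D = real k" "0 < k" "k \<le> D"
    and lt: "quantile q (image_mset z (mset_set {..<D})) < t"
  shows "card {j. j < D \<and> z j < t} \<ge> k"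
proof -
  define l where "l = sorted_list_of_multiset (image_mset z (mset_set {..<D}))"
  have ml: "mset l = image_mset z (mset_set {..<D})" by (simp add: l_def)
  have len: "length l = D" by (simp flip: size_mset add: ml)
  have lt': "l ! (k - 1) < t"
    using lt k by (simp add: quantile_def l_def max_def)
  have "{..<k} \<subseteq> {i. i < length l \<and> l ! i < t}"
  proof safe
    fix i assume i: "i < k"
    have "sorted l" by (simp add: l_def)
    then have "l ! i \<le> l ! (k - 1)" using len i k by (intro sorted_nth_mono) auto
    then show "l ! i < t" using lt' by simp
  qed (use k len in auto)
  then have "card {..<k} \<le> card {i. i < length l \<and> l ! i < t}"
    by (intro card_mono) auto
  also have "\<dots> = card {j \<in> {..<D}. z j < t}"
    unfolding card_filter_nth_mset[of l "\<lambda>x. x < t"] ml by (simp add: size_filter_image_mset_set)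
  finally show ?thesis by simp
qed

text \<open>Ties make it impossible in general to have exactly \<open>p\<close> values below a threshold.\<close>

lemma population_threshold:
  fixes z :: "nat \<Rightarrow> real"
  assumes m: "m > 0" and p: "0 < p" "p \<le> real m"
  shows "\<exists>t. real (card {r. r < m \<and> z r < t}) \<le> p \<and> p \<le> real (card {r. r < m \<and> z r \<le> t})"
proof -
  \<comment> \<open>The threshold is the least attained value whose closed sublevel set has at least
    \<open>p\<close> elements.\<close>
  define V where "V = {v \<in> z ` {..<m}. p \<le> real (card {r. r < m \<and> z r \<le> v})}"
  have fin: "finite V" by (simp add: V_def)
  have "Max (z ` {..<m}) \<in> V"
  proof -
    have "z ` {..<m} \<noteq> {}" using m by auto
    then have "Max (z ` {..<m}) \<in> z ` {..<m}" by (intro Max_in) auto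
    moreover have "{r. r < m \<and> z r \<le> Max (z ` {..<m})} = {..<m}" by auto
    ultimately show ?thesis using p by (simp add: V_def)
  qed
  then have ne: "V \<noteq> {}" by blast
  define t where "t = Min V"
  have t: "t \<in> V" unfolding t_def using fin ne by (rule Min_in)
  have "real (card {r. r < m \<and> z r < t}) \<le> p"
  proof (cases "{r. r < m \<and> z r < t} = {}")
    case False
    \<comment> \<open>The largest value below \<open>t\<close> misses \<open>V\<close> by
      minimality, and its closed sublevel set contains the open one of \<open>t\<close>.\<close>
    define W where "W = z ` {r. r < m \<and> z r < t}"
    have W: "finite W" "W \<noteq> {}" using False by (auto simp: W_def)
    have w: "Max W \<in> W" using W by (rule Max_in)
    have "Max W \<notin> V"
      using w Min_le[OF fin, of "Max W"] by (auto simp: W_def t_def)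
    then have "real (card {r. r < m \<and> z r \<le> Max W}) < p" using w by (auto simp: V_def W_def)
    moreover have "{r. r < m \<and> z r < t} \<subseteq> {r. r < m \<and> z r \<le> Max W}"
      using W(1) by (auto simp: W_def)
    then have "card {r. r < m \<and> z r < t} \<le> card {r. r < m \<and> z r \<le> Max W}"
      by (intro card_mono) auto
    ultimately show ?thesis by linarith
  next
    case True
    then show ?thesis using p by (simp only: card.empty)
  qed
  then show ?thesis using t by (auto simp: V_def)
qed

section \<open>Products of finitely supported distributions\<close>

lemma finite_set_Pi_pmf:
  assumes "finite A" "\<And>a. a \<in> A \<Longrightarrow> finite (set_pmf (p a))"
  shows "finite (set_pmf (Pi_pmf A d p))"
  using assms by (simp add: set_Pi_pmf finite_PiE_dflt)

lemma expectation_pair_pmf: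
  fixes f :: "'a \<times> 'b \<Rightarrow> real"
  assumes "finite (set_pmf p)" "finite (set_pmf q)"
  shows "measure_pmf.expectation (pair_pmf p q) f =
    measure_pmf.expectation p (\<lambda>x. measure_pmf.expectation q (\<lambda>y. f (x, y)))"
proof -
  have "measure_pmf.expectation (pair_pmf p q) f = (\<Sum>(x, y)\<in>set_pmf p \<times> set_pmf q. f (x, y) * (pmf p x * pmf q y))"
    using assms by (subst integral_measure_pmf_real[of "set_pmf p \<times> set_pmf q"]) (auto simp: pmf_pair intro!: sum.cong)
  also have "\<dots> = (\<Sum>x\<in>set_pmf p. (\<Sum>y\<in>set_pmf q. f (x, y) * pmf q y) * pmf p x)"
    by (simp add: sum.cartesian_product[symmetric] sum_distrib_left mult_ac)
  also have "\<dots> = measure_pmf.expectation p (\<lambda>x. measure_pmf.expectation q (\<lambda>y. f (x, y)))"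
    using assms by (simp add: integral_measure_pmf_real[of "set_pmf p"] integral_measure_pmf_real[of "set_pmf q"])
  finally show ?thesis .
qed

text \<open>The law of one quantile subsample. The filler 0 agrees with \<open>draws_pmf\<close>, so
  that this is literally a factor of it.\<close>

definition samples_pmf :: "nat \<Rightarrow> nat \<Rightarrow> (nat \<Rightarrow> nat) pmf" where
  "samples_pmf m D = Pi_pmf {..<D} 0 (\<lambda>_. pmf_of_set {..<m})"

lemma finite_set_samples_pmf: "m > 0 \<Longrightarrow> finite (set_pmf (samples_pmf m D))"
  unfolding samples_pmf_def by (intro finite_set_Pi_pmf) (auto simp: lessThan_empty_iff)

lemma markov_finite_pmf:
  fixes f :: "'a \<Rightarrow> real"
  assumes fin: "finite (set_pmf p)" and f: "\<And>x. f x \<ge> 0" and a: "a > 0" "\<And>x. x \<in> E \<Longrightarrow> a \<le> f x"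
  shows "measure_pmf.prob p E \<le> measure_pmf.expectation p f / a"
proof -
  have "a * measure_pmf.prob p E = measure_pmf.expectation p (\<lambda>x. a * indicator E x)"
    by simp
  also have "\<dots> \<le> measure_pmf.expectation p f"
    by (intro integral_mono integrable_measure_pmf_finite fin) (auto simp: indicator_def f a)
  finally show ?thesis using a by (simp add: field_simps)
qed

text \<open>Markov's inequality for \<open>(1 / p) ^ N\<close>, where \<open>N\<close> counts the samples in \<open>B\<close>.\<close>

lemma samples_count_ge_prob:
  fixes p :: real
  assumes m: "m > 0" and B: "real (card ({..<m} \<inter> B)) \<le> p * real m" and p: "0 < p" "p \<le> 1"
  shows "measure_pmf.prob (samples_pmf m D) {i. card {j. j < D \<and> i j \<in> B} \<ge> s} \<le> 2 ^ D * p ^ s"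
proof -
  define w :: "nat \<Rightarrow> real" where "w x = (if x \<in> B then 1 / p else 1)" for x
  have w1: "w x \<ge> 1" for x using p by (auto simp: w_def)
  have prodw: "(\<Prod>j<D. w (i j)) = (1 / p) ^ card {j. j < D \<and> i j \<in> B}" for i :: "nat \<Rightarrow> nat"
  proof -
    have "(\<Prod>j<D. w (i j)) = (\<Prod>j\<in>{j \<in> {..<D}. i j \<in> B}. 1 / p)"
      by (simp only: w_def flip: prod.inter_filter[OF finite_lessThan])
    then show ?thesis by simp
  qed
  \<comment> \<open>The mean is at most \<open>1 + p * (1 / p - 1) = 2 - p\<close>; by independence
    the product of \<open>D\<close> weights has mean at most \<open>2 ^ D\<close>.\<close>
  have sumw: "measure_pmf.expectation (pmf_of_set {..<m}) w \<le> 2"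
  proof -
    have "(\<Sum>x<m. w x) = (\<Sum>x<m. 1 + (if x \<in> B then 1 / p - 1 else 0))"
      by (intro sum.cong) (auto simp: w_def)
    also have "\<dots> = real m + real (card ({..<m} \<inter> B)) * (1 / p - 1)"
      by (simp add: sum.distrib sum.inter_restrict[symmetric])
    also have "real (card ({..<m} \<inter> B)) * (1 / p - 1) \<le> (p * real m) * (1 / p - 1)"
      using B p by (intro mult_right_mono) auto
    also have "\<dots> \<le> real m" using p by (simp add: field_simps)
    finally show ?thesis using m by (subst integral_pmf_of_set) (auto simp: field_simps)
  qed
  have "measure_pmf.prob (samples_pmf m D) {i. card {j. j < D \<and> i j \<in> B} \<ge> s}
      \<le> measure_pmf.expectation (samples_pmf m D) (\<lambda>i. \<Prod>j<D. w (i j)) / (1 / p) ^ s"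
  proof (rule markov_finite_pmf)
    show "0 \<le> (\<Prod>j<D. w (x j))" for x using w1 by (intro prod_nonneg) (meson order_trans zero_le_one)
    show "(1 / p) ^ s \<le> (\<Prod>j<D. w (x j))" if "x \<in> {i. card {j. j < D \<and> i j \<in> B} \<ge> s}" for x
      unfolding prodw using that p by (intro power_increasing) auto
  qed (use p m finite_set_samples_pmf in auto)
  also have "measure_pmf.expectation (samples_pmf m D) (\<lambda>i. \<Prod>j<D. w (i j))
      = (\<Prod>j<D. measure_pmf.expectation (pmf_of_set {..<m}) w)"
    unfolding samples_pmf_def
    using m by (intro expectation_prod_Pi_pmf) (auto simp: lessThan_empty_iff intro!: integrable_measure_pmf_finite order_trans[OF zero_le_one w1])
  also have "\<dots> \<le> 2 ^ D"
    unfolding prod_constant using sumw w1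
    by (simp, intro power_mono Bochner_Integration.integral_nonneg) (auto intro: order_trans[OF zero_le_one])
  finally show ?thesis using p by (simp add: power_divide divide_right_mono)
qed

lemma expectation_sum_Pi_pmf_component:
  fixes f :: "'b \<Rightarrow> real"
  assumes "finite A" "\<And>a. a \<in> A \<Longrightarrow> finite (set_pmf (p a))"
  shows "measure_pmf.expectation (Pi_pmf A d p) (\<lambda>i. \<Sum>a\<in>A. f (i a)) =
    (\<Sum>a\<in>A. measure_pmf.expectation (p a) f)"
proof -
  have "measure_pmf.expectation (Pi_pmf A d p) (\<lambda>i. f (i a)) = measure_pmf.expectation (p a) f"
    if "a \<in> A" for a
  proof -
    have "measure_pmf.expectation (Pi_pmf A d p) (\<lambda>i. f (i a))
        = measure_pmf.expectation (map_pmf (\<lambda>i. i a) (Pi_pmf A d p)) f" by simp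
    also have "map_pmf (\<lambda>i. i a) (Pi_pmf A d p) = p a"
      using assms that by (simp add: Pi_pmf_component)
    finally show ?thesis .
  qed
  then show ?thesis
    by (subst Bochner_Integration.integral_sum)
      (auto intro!: integrable_measure_pmf_finite finite_set_Pi_pmf assms)
qed

text \<open>Markov's inequality for the count itself. It serves sets of rows that are not rare: for
  \<open>p = 3 * q / 4\<close> and \<open>k = q * D\<close> it gives 3/4 for every \<open>D\<close>,
  where the factor \<open>2 ^ D\<close> of the exponential bound would be too large.\<close>

lemma samples_count_ge_prob_markov:
  assumes m: "m > 0" and B: "real (card ({..<m} \<inter> B)) \<le> p * real m" and k: "k > 0"
  shows "measure_pmf.prob (samples_pmf m D) {i. card {j. j < D \<and> i j \<in> B} \<ge> k} \<le> p * real D / real k"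
proof -
  have cnt: "(\<Sum>j<D. indicator B (i j)) = real (card {j. j < D \<and> i j \<in> B})" for i :: "nat \<Rightarrow> nat"
    by (simp add: indicator_def sum.If_cases) (auto intro!: arg_cong[of _ _ card])
  have "measure_pmf.prob (samples_pmf m D) {i. card {j. j < D \<and> i j \<in> B} \<ge> k}
      \<le> measure_pmf.expectation (samples_pmf m D) (\<lambda>i. \<Sum>j<D. indicator B (i j)) / real k"
    by (rule markov_finite_pmf) (use k m finite_set_samples_pmf in \<open>auto simp: cnt\<close>)
  also have "measure_pmf.expectation (samples_pmf m D) (\<lambda>i. \<Sum>j<D. indicator B (i j) :: real)
      = (\<Sum>j<D. measure_pmf.expectation (pmf_of_set {..<m}) (indicator B))"
    unfolding samples_pmf_def
    using m by (intro expectation_sum_Pi_pmf_component[where f = "indicator B"]) (auto simp: lessThan_empty_iff)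
  also have "measure_pmf.expectation (pmf_of_set {..<m}) (indicator B :: nat \<Rightarrow> real) = real (card ({..<m} \<inter> B)) / real m"
    using m by (subst integral_pmf_of_set) (auto simp: indicator_def sum.If_cases)
  also have "(\<Sum>j<D. real (card ({..<m} \<inter> B)) / real m) \<le> (\<Sum>j<D. p)"
    using B m by (intro sum_mono) (simp add: field_simps)
  also have "\<dots> = p * real D" by simp
  finally show ?thesis using k by (simp add: divide_right_mono)
qed

section \<open>Iteration of a random step\<close>

text \<open>Abstract form of \<open>quantileRK\<close>, with arbitrary states and draws, on which
  the inductions over the number of steps are carried out.\<close>

primrec iterate :: "('d \<Rightarrow> 's \<Rightarrow> 's) \<Rightarrow> 's \<Rightarrow> (nat \<Rightarrow> 'd) \<Rightarrow> nat \<Rightarrow> 's" where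
  "iterate step x \<omega> 0 = x"
| "iterate step x \<omega> (Suc k) = step (\<omega> k) (iterate step x \<omega> k)"

lemma iterate_upd: "k \<le> T \<Longrightarrow> iterate step x (fun_upd \<omega> T y) k = iterate step x \<omega> k"
  by (induction k) auto

text \<open>Conditioning on the past: by independence the last draw can be averaged first with the
  earlier ones held fixed.\<close>

lemma expectation_Pi_pmf_Suc:
  fixes F :: "(nat \<Rightarrow> 'd) \<Rightarrow> real"
  assumes "finite (set_pmf p)"
  shows "measure_pmf.expectation (Pi_pmf {..<Suc T} d (\<lambda>_. p)) F =
    measure_pmf.expectation (Pi_pmf {..<T} d (\<lambda>_. p)) (\<lambda>\<omega>. measure_pmf.expectation p (\<lambda>y. F (fun_upd \<omega> T y)))"
proof -
  have "Pi_pmf {..<Suc T} d (\<lambda>_. p) = map_pmf (\<lambda>(y, \<omega>). fun_upd \<omega> T y) (pair_pmf p (Pi_pmf {..<T} d (\<lambda>_. p)))"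
    by (simp add: lessThan_Suc Pi_pmf_insert)
  also have "\<dots> = map_pmf (\<lambda>(\<omega>, y). fun_upd \<omega> T y) (pair_pmf (Pi_pmf {..<T} d (\<lambda>_. p)) p)"
    by (subst pair_commute_pmf) (simp add: pmf.map_comp o_def case_prod_unfold)
  finally show ?thesis
    using assms by (simp add: expectation_pair_pmf finite_set_Pi_pmf)
qed

text \<open>A trajectory counts only as long as all its steps are \<open>ok\<close>. Given the first
  \<open>T\<close> draws, averaging the last one costs a factor \<open>\<rho>\<close>, so the
  factors multiply. The set \<open>I\<close> of states is preserved by the steps; later it consists
  of the vectors of the right dimension.\<close>

lemma iterate_expectation_bound:
  fixes V :: "'s \<Rightarrow> real"
  assumes fin: "finite (set_pmf p)" and x: "x \<in> I" and inv: "\<And>d y. y \<in> I \<Longrightarrow> step d y \<in> I"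
    and rho: "0 \<le> \<rho>"
    and contr: "\<And>y. y \<in> I \<Longrightarrow> measure_pmf.expectation p (\<lambda>d. V (step d y) * of_bool (ok d y)) \<le> \<rho> * V y"
  shows "measure_pmf.expectation (Pi_pmf {..<T} d0 (\<lambda>_. p))
    (\<lambda>\<omega>. V (iterate step x \<omega> T) * of_bool (\<forall>k<T. ok (\<omega> k) (iterate step x \<omega> k))) \<le> \<rho> ^ T * V x"
proof (induction T)
  case (Suc T)
  let ?P = "Pi_pmf {..<T} d0 (\<lambda>_. p)"
  let ?X = "iterate step x"
  have X: "?X \<omega> k \<in> I" for \<omega> k by (induction k) (auto simp: x inv)
  have "measure_pmf.expectation (Pi_pmf {..<Suc T} d0 (\<lambda>_. p))
      (\<lambda>\<omega>. V (?X \<omega> (Suc T)) * of_bool (\<forall>k<Suc T. ok (\<omega> k) (?X \<omega> k)))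
    = measure_pmf.expectation ?P (\<lambda>\<omega>. measure_pmf.expectation p
        (\<lambda>d. V (step d (?X \<omega> T)) * of_bool (ok d (?X \<omega> T))) * of_bool (\<forall>k<T. ok (\<omega> k) (?X \<omega> k)))"
    unfolding expectation_Pi_pmf_Suc[OF fin]
    by (simp add: iterate_upd less_Suc_eq all_conj_distrib of_bool_conj mult_ac imp_conjL flip: integral_mult_right_zero)
  also have "\<dots> \<le> measure_pmf.expectation ?P
      (\<lambda>\<omega>. (\<rho> * V (?X \<omega> T)) * of_bool (\<forall>k<T. ok (\<omega> k) (?X \<omega> k)))"
    by (intro integral_mono integrable_measure_pmf_finite finite_set_Pi_pmf fin mult_right_mono contr X) auto
  also have "\<dots> = \<rho> * measure_pmf.expectation ?P
      (\<lambda>\<omega>. V (?X \<omega> T) * of_bool (\<forall>k<T. ok (\<omega> k) (?X \<omega> k)))"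
    by (simp add: mult.assoc)
  also have "\<dots> \<le> \<rho> * (\<rho> ^ T * V x)" by (intro mult_left_mono Suc.IH rho)
  finally show ?case by (simp add: mult.assoc)
qed simp

text \<open>A union bound over the steps: conditionally on any past, the next step fails with
  probability at most \<open>\<delta>\<close>.\<close>

lemma iterate_failure_prob:
  assumes fin: "finite (set_pmf p)" and x: "x \<in> I" and inv: "\<And>d y. y \<in> I \<Longrightarrow> step d y \<in> I"
    and fail: "\<And>y. y \<in> I \<Longrightarrow> measure_pmf.prob p {d. \<not> ok d y} \<le> \<delta>"
  shows "measure_pmf.prob (Pi_pmf {..<T} d0 (\<lambda>_. p))
    {\<omega>. \<exists>k<T. \<not> ok (\<omega> k) (iterate step x \<omega> k)} \<le> real T * \<delta>"
proof (induction T)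
  case (Suc T)
  let ?P = "\<lambda>T. Pi_pmf {..<T} d0 (\<lambda>_. p)"
  let ?X = "iterate step x"
  let ?F = "\<lambda>T. {\<omega>. \<exists>k<T. \<not> ok (\<omega> k) (?X \<omega> k)}"
  have X: "?X \<omega> k \<in> I" for \<omega> k by (induction k) (auto simp: x inv)
  have "measure_pmf.prob (?P (Suc T)) (?F (Suc T)) = measure_pmf.expectation (?P (Suc T)) (indicator (?F (Suc T)))"
    by simp
  also have "\<dots> = measure_pmf.expectation (?P T)
      (\<lambda>\<omega>. measure_pmf.expectation p (\<lambda>y. indicator (?F (Suc T)) (fun_upd \<omega> T y)))"
    by (rule expectation_Pi_pmf_Suc[OF fin])
  also have "\<dots> \<le> measure_pmf.expectation (?P T)
      (\<lambda>\<omega>. measure_pmf.expectation p (\<lambda>y. indicator (?F T) \<omega> + indicator {d. \<not> ok d (?X \<omega> T)} y))"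
    by (intro integral_mono integrable_measure_pmf_finite finite_set_Pi_pmf fin)
      (auto simp: indicator_def less_Suc_eq iterate_upd)
  also have "\<dots> = measure_pmf.expectation (?P T)
      (\<lambda>\<omega>. indicator (?F T) \<omega> + measure_pmf.prob p {d. \<not> ok d (?X \<omega> T)})"
    by (subst Bochner_Integration.integral_add)
      (auto intro!: integrable_measure_pmf_finite fin)
  also have "\<dots> \<le> measure_pmf.expectation (?P T) (\<lambda>\<omega>. indicator (?F T) \<omega> + \<delta>)"
    by (intro integral_mono integrable_measure_pmf_finite finite_set_Pi_pmf fin add_left_mono fail X) auto
  also have "\<dots> = measure_pmf.prob (?P T) (?F T) + \<delta>"
    by (subst Bochner_Integration.integral_add)
      (auto intro!: integrable_measure_pmf_finite finite_set_Pi_pmf fin)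
  finally show ?case using Suc.IH by (simp add: algebra_simps)
qed simp

section \<open>One step in terms of residuals\<close>

text \<open>Below, \<open>g r\<close> is the exact residual \<open>a\<^sub>r \<bullet> (x - x\<^sup>*)\<close>, \<open>\<epsilon> r\<close> the corruption of row \<open>r\<close>, and \<open>N\<close> is
  \<open>\<parallel>x - x\<^sup>*\<parallel>\<^sup>2\<close>.\<close>

lemma large_rows_card:
  fixes g \<epsilon> :: "nat \<Rightarrow> real"
  assumes n: "n > 0" and C: "C > 0" and \<beta>: "0 < \<beta>" "\<beta> \<le> 1" and N: "N \<ge> 0"
    and sq: "(\<Sum>r<m. (g r)\<^sup>2) \<le> C\<^sup>2 * real m / real n * N"
    and Z: "real (card {r. r < m \<and> \<epsilon> r \<noteq> 0}) \<le> \<beta> * real m"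
  shows "real (card {r. r < m \<and> \<bar>g r - \<epsilon> r\<bar> > sqrt (C\<^sup>2 * N / (sqrt \<beta> * real n))}) \<le> 2 * sqrt \<beta> * real m"
proof -
  \<comment> \<open>The square of the moderate level, chosen so that a Chebyshev bound leaves a
    fraction \<open>sqrt \<beta>\<close> of exact residuals above it.\<close>
  define \<tau> where "\<tau> = C\<^sup>2 * N / (sqrt \<beta> * real n)"
  have \<tau>: "\<tau> \<ge> 0" using \<beta> N by (auto simp: \<tau>_def)
  define L where "L = {r. r < m \<and> (g r)\<^sup>2 > \<tau>}"
  have L: "real (card L) \<le> sqrt \<beta> * real m"
  \<comment> \<open>For \<open>N = 0\<close> also \<open>\<tau> = 0\<close>, which cannot be
    cancelled; there all exact residuals vanish.\<close>
  proof (cases "N = 0")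
    case True
    then have "(\<Sum>r<m. (g r)\<^sup>2) = 0" using sq sum_nonneg[of "{..<m}" "\<lambda>r. (g r)\<^sup>2"] by auto
    then have "\<forall>r\<in>{..<m}. (g r)\<^sup>2 = 0" by (subst sum_nonneg_eq_0_iff[symmetric]) auto
    then have "L = {}" using \<tau> by (auto simp: L_def)
    then show ?thesis using \<beta> by simp
  next
    case False
    have "real (card L) * \<tau> = (\<Sum>r\<in>L. \<tau>)" by simp
    also have "\<dots> \<le> (\<Sum>r\<in>L. (g r)\<^sup>2)" by (intro sum_mono) (auto simp: L_def)
    also have "\<dots> \<le> (\<Sum>r<m. (g r)\<^sup>2)" by (intro sum_mono2) (auto simp: L_def)
    also note sq
    also have "C\<^sup>2 * real m / real n * N = (sqrt \<beta> * real m) * \<tau>"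
      using n \<beta> by (simp add: \<tau>_def)
    finally have le: "real (card L) * \<tau> \<le> (sqrt \<beta> * real m) * \<tau>" .
    have "\<tau> > 0" using False N n C \<beta> by (auto simp: \<tau>_def)
    then show ?thesis using le by simp
  qed
  have "{r. r < m \<and> \<bar>g r - \<epsilon> r\<bar> > sqrt \<tau>} \<subseteq> {r. r < m \<and> \<epsilon> r \<noteq> 0} \<union> L"
  proof safe
    fix r assume r: "r < m" "sqrt \<tau> < \<bar>g r - \<epsilon> r\<bar>" "r \<notin> L" "\<epsilon> r = 0"
    then show False using real_sqrt_le_mono[of "(g r)\<^sup>2" \<tau>] by (auto simp: L_def)
  qed
  then have "card {r. r < m \<and> \<bar>g r - \<epsilon> r\<bar> > sqrt \<tau>} \<le> card ({r. r < m \<and> \<epsilon> r \<noteq> 0} \<union> L)"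
    by (intro card_mono) (auto simp: L_def)
  also have "\<dots> \<le> card {r. r < m \<and> \<epsilon> r \<noteq> 0} + card L" by (rule card_Un_le)
  finally have "real (card {r. r < m \<and> \<bar>g r - \<epsilon> r\<bar> > sqrt \<tau>}) \<le> \<beta> * real m + sqrt \<beta> * real m"
    using Z L by linarith
  also have "\<beta> \<le> sqrt \<beta>" using \<beta> by (intro real_le_rsqrt) (simp add: power2_eq_square mult_left_le)
  then have "\<beta> * real m + sqrt \<beta> * real m \<le> 2 * sqrt \<beta> * real m"
    using mult_right_mono[of \<beta> "sqrt \<beta>" "real m"] by (simp add: mult.commute)
  finally show ?thesis by (simp add: \<tau>_def)
qed

text \<open>An accepted uncorrupted row replaces \<open>N\<close> by
  \<open>N - (g r)\<^sup>2\<close>. An accepted corrupted row has a residual of square at most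
  \<open>\<tau>\<close>, so its harm splits into a small multiple of \<open>(g r)\<^sup>2\<close>,
  summed by \<open>sq\<close>, and a multiple of \<open>\<tau>\<close>, paid for by the
  sparsity.\<close>

lemma accepted_rows_sum:
  fixes g \<epsilon> :: "nat \<Rightarrow> real"
  assumes n: "n > 0" and \<beta>: "0 < \<beta>" "\<beta> \<le> 1" and N: "N \<ge> 0"
    and sq: "(\<Sum>r<m. (g r)\<^sup>2) \<le> C\<^sup>2 * real m / real n * N"
    and Z: "real (card {r. r < m \<and> \<epsilon> r \<noteq> 0}) \<le> \<beta> * real m"
    and Q: "Q \<le> sqrt (C\<^sup>2 * N / (sqrt \<beta> * real n))"
  shows "(\<Sum>r<m. if \<bar>g r - \<epsilon> r\<bar> \<le> Q then N - 2 * (g r - \<epsilon> r) * g r + (g r - \<epsilon> r)\<^sup>2 else N)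
    \<le> real m * N * (1 + 3 * C\<^sup>2 * sqrt (sqrt \<beta>) / real n)
      - (\<Sum>r\<in>{r. r < m \<and> \<bar>g r - \<epsilon> r\<bar> \<le> Q \<and> \<epsilon> r = 0}. (g r)\<^sup>2)"
proof -
  define \<tau> where "\<tau> = C\<^sup>2 * N / (sqrt \<beta> * real n)"
  have \<tau>: "\<tau> \<ge> 0" using \<beta> N by (auto simp: \<tau>_def)
  define \<eta> where "\<eta> = sqrt (sqrt \<beta>)"
  have \<eta>: "0 < \<eta>" "\<eta> \<le> 1" "\<eta>\<^sup>2 = sqrt \<beta>"
    using \<beta> by (auto simp: \<eta>_def)
  have beta_eq: "\<beta> = \<eta> ^ 4"
    using \<beta> power_mult[of \<eta> 2 2] by (simp add: \<eta>)
  have row_bound: "(if \<bar>g r - \<epsilon> r\<bar> \<le> Q then N - 2 * (g r - \<epsilon> r) * g r + (g r - \<epsilon> r)\<^sup>2 else N)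
    \<le> N - (if \<bar>g r - \<epsilon> r\<bar> \<le> Q \<and> \<epsilon> r = 0 then (g r)\<^sup>2 else 0) + \<eta> * (g r)\<^sup>2
      + (if \<epsilon> r \<noteq> 0 then \<tau> * (1 / \<eta> + 1) else 0)" for r
  proof (cases "\<bar>g r - \<epsilon> r\<bar> \<le> Q \<and> \<epsilon> r \<noteq> 0")
    case True
    define h where "h = g r - \<epsilon> r"
    have "\<bar>h\<bar> \<le> sqrt \<tau>" using True Q by (simp add: h_def \<tau>_def)
    then have "\<bar>h\<bar>\<^sup>2 \<le> (sqrt \<tau>)\<^sup>2" by (intro power_mono) auto
    then have h: "h\<^sup>2 \<le> \<tau>" using \<tau> by simp
    \<comment> \<open>AM-GM with weight \<open>\<eta> = \<beta>\<^bsup>1/4\<^esup>\<close>, which balances the two resulting error terms\<close>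
    have "0 \<le> (\<eta> * g r + h)\<^sup>2 / \<eta>" using \<eta> by simp
    also have "\<dots> = \<eta> * (g r)\<^sup>2 + 2 * h * g r + h\<^sup>2 / \<eta>"
      using \<eta> by (simp add: power2_eq_square field_simps)
    finally have "- 2 * h * g r \<le> \<eta> * (g r)\<^sup>2 + h\<^sup>2 / \<eta>" by simp
    moreover have "h\<^sup>2 / \<eta> + h\<^sup>2 \<le> \<tau> / \<eta> + \<tau>"
      using h \<eta> by (intro add_mono divide_right_mono) auto
    ultimately show ?thesis using True by (simp add: h_def[symmetric] algebra_simps)
  next
    case False
    then show ?thesis using \<eta> \<tau> by (auto simp: power2_eq_square)
  qed
  have "(\<Sum>r<m. if \<bar>g r - \<epsilon> r\<bar> \<le> Q then N - 2 * (g r - \<epsilon> r) * g r + (g r - \<epsilon> r)\<^sup>2 else N)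
    \<le> (\<Sum>r<m. N - (if \<bar>g r - \<epsilon> r\<bar> \<le> Q \<and> \<epsilon> r = 0 then (g r)\<^sup>2 else 0) + \<eta> * (g r)\<^sup>2
      + (if \<epsilon> r \<noteq> 0 then \<tau> * (1 / \<eta> + 1) else 0))"
    by (intro sum_mono row_bound)
  also have "\<dots> = real m * N - (\<Sum>r\<in>{r. r < m \<and> \<bar>g r - \<epsilon> r\<bar> \<le> Q \<and> \<epsilon> r = 0}. (g r)\<^sup>2)
      + \<eta> * (\<Sum>r<m. (g r)\<^sup>2) + real (card {r. r < m \<and> \<epsilon> r \<noteq> 0}) * (\<tau> * (1 / \<eta> + 1))"
    using sum.inter_filter[of "{..<m}" "\<lambda>r. (g r)\<^sup>2" "\<lambda>r. \<bar>g r - \<epsilon> r\<bar> \<le> Q \<and> \<epsilon> r = 0"]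
      sum.inter_filter[of "{..<m}" "\<lambda>r. \<tau> * (1 / \<eta> + 1)" "\<lambda>r. \<epsilon> r \<noteq> 0"]
    by (simp add: sum.distrib sum_subtractf sum_distrib_left)
  also have "\<eta> * (\<Sum>r<m. (g r)\<^sup>2) \<le> \<eta> * (C\<^sup>2 * real m / real n * N)"
    using \<eta> by (intro mult_left_mono sq) auto
  also have "real (card {r. r < m \<and> \<epsilon> r \<noteq> 0}) * (\<tau> * (1 / \<eta> + 1)) \<le> (\<beta> * real m) * (\<tau> * (2 / \<eta>))"
    using \<eta> \<tau> \<beta>(1) by (intro mult_mono Z mult_left_mono) (auto simp: field_simps)
  \<comment> \<open>The factor \<open>\<beta> = \<eta> ^ 4\<close> meets
    \<open>1 / \<eta>\<^sup>2\<close> from \<open>\<tau>\<close> and \<open>1 / \<eta>\<close>,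
    which leaves one \<open>\<eta>\<close>. With the previous term this makes the constant
    3.\<close>
  also have "(\<beta> * real m) * (\<tau> * (2 / \<eta>)) = 2 * \<eta> * (C\<^sup>2 * real m / real n * N)"
  proof -
    have "\<tau> = C\<^sup>2 * N / (\<eta>\<^sup>2 * real n)" using \<eta> by (simp add: \<tau>_def)
    then show ?thesis using \<eta>(1) n by (simp add: beta_eq field_simps power4_eq_xxxx power2_eq_square)
  qed
  finally show ?thesis by (simp add: \<eta>_def[symmetric] algebra_simps)
qed

text \<open>A quantile above the level puts at least \<open>D - k\<close> samples into the rows with
  large residual, which are only a fraction \<open>2 * sqrt \<beta>\<close> of all rows.\<close>

lemma one_step_failure:
  fixes g \<epsilon> :: "nat \<Rightarrow> real"
  assumes m: "m > 0" and n: "n > 0" and C: "C > 0" and \<beta>: "0 < \<beta>" "2 * sqrt \<beta> \<le> 1" and N: "N \<ge> 0"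
    and sq: "(\<Sum>r<m. (g r)\<^sup>2) \<le> C\<^sup>2 * real m / real n * N"
    and Z: "real (card {r. r < m \<and> \<epsilon> r \<noteq> 0}) \<le> \<beta> * real m"
    and D: "D > 0" and k: "q * real D = real k" "0 < k" "k \<le> D"
  shows "measure_pmf.prob (samples_pmf m D)
      {i. \<not> quantile q (image_mset (\<lambda>j. \<bar>g (i j) - \<epsilon> (i j)\<bar>) (mset_set {..<D}))
          \<le> sqrt (C\<^sup>2 * N / (sqrt \<beta> * real n))}
    \<le> 2 ^ D * (2 * sqrt \<beta>) ^ (D - k)"
proof -
  define \<tau> where "\<tau> = sqrt (C\<^sup>2 * N / (sqrt \<beta> * real n))"
  define B where "B = {r. \<bar>g r - \<epsilon> r\<bar> > \<tau>}"
  have "\<beta> \<le> 1"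
    using \<beta> real_sqrt_le_1_iff[of \<beta>] real_sqrt_ge_0_iff[of \<beta>] by linarith
  then have B: "real (card ({..<m} \<inter> B)) \<le> 2 * sqrt \<beta> * real m"
    using large_rows_card[OF n C \<beta>(1) _ N sq Z] by (simp add: B_def \<tau>_def lessThan_def Collect_conj_eq)
  have "measure_pmf.prob (samples_pmf m D)
      {i. \<not> quantile q (image_mset (\<lambda>j. \<bar>g (i j) - \<epsilon> (i j)\<bar>) (mset_set {..<D})) \<le> \<tau>}
    \<le> measure_pmf.prob (samples_pmf m D) {i. card {j. j < D \<and> i j \<in> B} \<ge> D - k}"
    using quantile_greater_card[OF D k, of \<tau>]
    by (intro measure_pmf.finite_measure_mono) (auto simp: B_def not_le)
  also have "\<dots> \<le> 2 ^ D * (2 * sqrt \<beta>) ^ (D - k)"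
    using \<beta> by (intro samples_count_ge_prob m B) auto
  finally show ?thesis by (simp add: \<tau>_def)
qed

text \<open>Let \<open>t\<close> be a population quantile of order \<open>3 * q / 4\<close>. If
  \<open>Q i \<ge> t\<close>, then removing at most \<open>q / 4 * m\<close> corrupted rows from the
  accepted ones leaves enough for \<open>low\<close>. This happens with probability at least 1/4,
  and the gain outweighs the harm bounded by \<open>small\<close>.\<close>

lemma one_step_contraction:
  fixes g \<epsilon> :: "nat \<Rightarrow> real"
  assumes m: "m > 0" and n: "n > 0" and N: "N \<ge> 0"
    and q: "0 < q" "q < 1" and a: "0 \<le> a" "a \<le> 1"
    and \<beta>: "0 < \<beta>" "\<beta> \<le> q / 4" and small: "3 * C\<^sup>2 * sqrt (sqrt \<beta>) \<le> a\<^sup>2 / 8"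
    and sq: "(\<Sum>r<m. (g r)\<^sup>2) \<le> C\<^sup>2 * real m / real n * N"
    and low: "\<And>S. S \<subseteq> {..<m} \<Longrightarrow> q / 2 * real m \<le> real (card S) \<Longrightarrow>
        a\<^sup>2 * real m / real n * N \<le> (\<Sum>r\<in>S. (g r)\<^sup>2)"
    and Z: "real (card {r. r < m \<and> \<epsilon> r \<noteq> 0}) \<le> \<beta> * real m"
    and D: "D > 0" and k: "q * real D = real k"
  defines "Q \<equiv> \<lambda>i. quantile q (image_mset (\<lambda>j. \<bar>g (i j) - \<epsilon> (i j)\<bar>) (mset_set {..<D}))"
  shows "measure_pmf.expectation (samples_pmf m D) (\<lambda>i.
      (\<Sum>r<m. if \<bar>g r - \<epsilon> r\<bar> \<le> Q i then N - 2 * (g r - \<epsilon> r) * g r + (g r - \<epsilon> r)\<^sup>2 else N) / real m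
        * of_bool (Q i \<le> sqrt (C\<^sup>2 * N / (sqrt \<beta> * real n))))
    \<le> (1 - a\<^sup>2 / 8 / real n) * N"
proof -
  have k': "0 < k" "k \<le> D"
    using quantile_index_bounds[OF q D k] by auto
  \<comment> \<open>The strict count limits the chance of \<open>Q i < t\<close>; the weak count
    gives the accepted rows once \<open>t \<le> Q i\<close>.\<close>
  obtain t where t1: "real (card {r. r < m \<and> \<bar>g r - \<epsilon> r\<bar> < t}) \<le> 3 * q / 4 * real m"
    and t2: "3 * q / 4 * real m \<le> real (card {r. r < m \<and> \<bar>g r - \<epsilon> r\<bar> \<le> t})"
    using population_threshold[OF m, of "3 * q / 4 * real m" "\<lambda>r. \<bar>g r - \<epsilon> r\<bar>"] q m by auto
  have probt: "measure_pmf.prob (samples_pmf m D) {i. Q i < t} \<le> 3 / 4"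
  proof -
    define B where "B = {r. \<bar>g r - \<epsilon> r\<bar> < t}"
    have "measure_pmf.prob (samples_pmf m D) {i. Q i < t}
        \<le> measure_pmf.prob (samples_pmf m D) {i. card {j. j < D \<and> i j \<in> B} \<ge> k}"
      using quantile_less_card[OF D k k', of _ t]
      by (intro measure_pmf.finite_measure_mono) (auto simp: B_def Q_def)
    also have "\<dots> \<le> 3 * q / 4 * real D / real k"
      using t1 by (intro samples_count_ge_prob_markov m k') (simp add: B_def lessThan_def Collect_conj_eq)
    also have "\<dots> = 3 / 4" using k k'(1) by (simp add: field_simps)
    finally show ?thesis .
  qed
  define \<delta> where "\<delta> = 3 * C\<^sup>2 * sqrt (sqrt \<beta>)"
  have \<delta>: "0 \<le> \<delta>" "\<delta> \<le> a\<^sup>2 / 8" using small \<beta> by (auto simp: \<delta>_def)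
  have a2: "a\<^sup>2 \<le> 1" using a by (simp add: power_le_one)
  define S where "S i = (\<Sum>r<m. if \<bar>g r - \<epsilon> r\<bar> \<le> Q i then N - 2 * (g r - \<epsilon> r) * g r + (g r - \<epsilon> r)\<^sup>2 else N)" for i
  have point: "S i / real m * of_bool (Q i \<le> sqrt (C\<^sup>2 * N / (sqrt \<beta> * real n)))
      \<le> N * (1 + \<delta> / real n - a\<^sup>2 / real n) + a\<^sup>2 / real n * N * indicator {i. Q i < t} i" for i
  proof (cases "Q i \<le> sqrt (C\<^sup>2 * N / (sqrt \<beta> * real n))")
    case True
    define G where "G = {r. r < m \<and> \<bar>g r - \<epsilon> r\<bar> \<le> Q i \<and> \<epsilon> r = 0}"
    have acc: "S i \<le> real m * N * (1 + \<delta> / real n) - (\<Sum>r\<in>G. (g r)\<^sup>2)"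
      unfolding S_def G_def \<delta>_def
      by (rule accepted_rows_sum[OF n \<beta>(1) _ N sq Z True]) (use \<beta> q in auto)
    have "(\<Sum>r\<in>G. (g r)\<^sup>2) \<ge> a\<^sup>2 * real m / real n * N * (1 - indicator {i. Q i < t} i)"
    proof (cases "Q i < t")
      case False
      have "{r. r < m \<and> \<bar>g r - \<epsilon> r\<bar> \<le> t} \<subseteq> G \<union> {r. r < m \<and> \<epsilon> r \<noteq> 0}"
        using False by (auto simp: G_def)
      then have "card {r. r < m \<and> \<bar>g r - \<epsilon> r\<bar> \<le> t} \<le> card (G \<union> {r. r < m \<and> \<epsilon> r \<noteq> 0})"
        by (intro card_mono) (auto simp: G_def)
      also have "\<dots> \<le> card G + card {r. r < m \<and> \<epsilon> r \<noteq> 0}" by (rule card_Un_le)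
      finally have "3 * q / 4 * real m \<le> real (card G) + \<beta> * real m" using t2 Z by linarith
      moreover have "\<beta> * real m \<le> q / 4 * real m" using \<beta> by (intro mult_right_mono) auto
      ultimately have "q / 2 * real m \<le> real (card G)" by (simp add: field_simps)
      then have "a\<^sup>2 * real m / real n * N \<le> (\<Sum>r\<in>G. (g r)\<^sup>2)" by (intro low) (auto simp: G_def)
      then show ?thesis using False by simp
    qed (simp add: sum_nonneg)
    then have "S i \<le> real m * N * (1 + \<delta> / real n) - a\<^sup>2 * real m / real n * N * (1 - indicator {i. Q i < t} i)"
      using acc by linarith
    then have "S i \<le> real m * (N * (1 + \<delta> / real n - a\<^sup>2 / real n) + a\<^sup>2 / real n * N * indicator {i. Q i < t} i)"
      by (simp add: algebra_simps diff_divide_distrib)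
    then show ?thesis using True m by (simp add: field_simps)
  next
    case False
    \<comment> \<open>Here the left side is 0, and \<open>a \<le> 1\<close> keeps the right side
      nonnegative.\<close>
    have "a\<^sup>2 / real n \<le> 1" using a2 n by (simp add: field_simps)
    moreover have "0 \<le> \<delta> / real n" using \<delta> by simp
    ultimately have "0 \<le> 1 + \<delta> / real n - a\<^sup>2 / real n" by linarith
    then show ?thesis using False N by simp
  qed
  have "measure_pmf.expectation (samples_pmf m D) (\<lambda>i. S i / real m * of_bool (Q i \<le> sqrt (C\<^sup>2 * N / (sqrt \<beta> * real n))))
    \<le> measure_pmf.expectation (samples_pmf m D)
      (\<lambda>i. N * (1 + \<delta> / real n - a\<^sup>2 / real n) + a\<^sup>2 / real n * N * indicator {i. Q i < t} i)"
    by (intro integral_mono integrable_measure_pmf_finite finite_set_samples_pmf m point)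
  also have "\<dots> = N * (1 + \<delta> / real n - a\<^sup>2 / real n)
      + a\<^sup>2 / real n * N * measure_pmf.prob (samples_pmf m D) {i. Q i < t}"
    by (subst Bochner_Integration.integral_add)
      (auto intro!: integrable_measure_pmf_finite finite_set_samples_pmf m)
  \<comment> \<open>The balance in units of \<open>a\<^sup>2 / n\<close> is
    \<open>1/8 - 1 + 3/4 = - 1/8\<close>.\<close>
  also have "\<dots> \<le> N * (1 + (a\<^sup>2 / 8) / real n - a\<^sup>2 / real n) + a\<^sup>2 / real n * N * (3 / 4)"
    using N by (intro add_mono mult_left_mono probt diff_mono divide_right_mono \<delta>) auto
  also have "\<dots> = (1 - a\<^sup>2 / 8 / real n) * N" using n by (simp add: field_simps)
  finally show ?thesis by (simp add: S_def)
qed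

section \<open>The algorithm\<close>

lemma euclid_norm_power2: "(euclid_norm v)\<^sup>2 = v \<bullet> v"
  by (simp add: euclid_norm_def scalar_prod_self_nonneg)

lemma quantileRK_conv_iterate:
  "quantileRK q D A b x0 \<omega> T = iterate (quantileRK_step q D A b) x0 \<omega> T"
  by (induction T) auto

lemma residual_decompose:
  assumes "A \<in> carrier_mat m n" "xs \<in> carrier_vec n" "\<epsilon> \<in> carrier_vec m" "x \<in> carrier_vec n" "r < m"
  shows "residual A (A *\<^sub>v xs + \<epsilon>) x r = Matrix.row A r \<bullet> (x - xs) - \<epsilon> $ r"
proof -
  have "Matrix.row A r \<in> carrier_vec n" using assms by auto
  then show ?thesis
    using assms by (simp add: residual_def scalar_prod_minus_distrib[of _ n])
qed

text \<open>The step length \<open>h\<close> is arbitrary, since a corrupted residual differs from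
  the exact one \<open>u \<bullet> (x - xs)\<close>.\<close>

lemma norm_project:
  fixes u :: "real Matrix.vec"
  assumes x: "x \<in> carrier_vec n" and xs: "xs \<in> carrier_vec n" and u: "u \<in> carrier_vec n" "u \<bullet> u = 1"
  shows "(x - h \<cdot>\<^sub>v u - xs) \<bullet> (x - h \<cdot>\<^sub>v u - xs) = (x - xs) \<bullet> (x - xs) - 2 * h * (u \<bullet> (x - xs)) + h\<^sup>2"
proof -
  have eq: "x - h \<cdot>\<^sub>v u - xs = (x - xs) - h \<cdot>\<^sub>v u"
    using x xs u by (intro eq_vecI) auto
  have e: "x - xs \<in> carrier_vec n" "h \<cdot>\<^sub>v u \<in> carrier_vec n" using x xs u by auto
  show ?thesis
    unfolding eq using e u comm_scalar_prod[OF u(1) e(1)]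
    by (simp add: scalar_prod_minus_distrib[of _ n] minus_scalar_prod_distrib[of _ n] power2_eq_square
        algebra_simps)
qed

text \<open>Markov's inequality at the level \<open>\<theta> ^ T * v\<close>. Because
  \<open>\<rho> \<le> \<theta>\<^sup>2\<close>, one factor \<open>\<theta> ^ T\<close> is spent on
  the level and the other remains as the probability.\<close>

lemma tail_from_expectation:
  fixes f :: "'a \<Rightarrow> real"
  assumes fin: "finite (set_pmf p)" and f: "\<And>x. f x \<ge> 0" and v: "v \<ge> 0"
    and rho: "0 \<le> \<rho>" "\<rho> \<le> \<theta>\<^sup>2" "0 < \<theta>"
    and E: "measure_pmf.expectation p f \<le> \<rho> ^ T * v"
  shows "measure_pmf.prob p {x. f x > \<theta> ^ T * v} \<le> \<theta> ^ T"
\<comment> \<open>The Markov level is 0 for \<open>v = 0\<close>; instead, the vanishing mean makes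
  \<open>f\<close> vanish almost surely.\<close>
proof (cases "v = 0")
  case True
  then have "measure_pmf.expectation p f = 0"
    using E f by (intro antisym Bochner_Integration.integral_nonneg) auto
  then have "AE x in p. f x = 0"
    using f by (subst (asm) integral_nonneg_eq_0_iff_AE) (auto intro!: integrable_measure_pmf_finite fin)
  then have "measure_pmf.prob p {x. f x > 0} = 0"
    by (subst measure_pmf.prob_eq_0) (auto elim!: eventually_mono)
  then show ?thesis using True rho by simp
next
  case False
  then have pos: "\<theta> ^ T * v > 0" using v rho by simp
  have "\<rho> ^ T \<le> (\<theta> ^ T)\<^sup>2"
    using power_mono[OF rho(2,1), of T] by (simp add: power_mult[symmetric] mult.commute)
  have "measure_pmf.prob p {x. f x > \<theta> ^ T * v} \<le> measure_pmf.expectation p f / (\<theta> ^ T * v)"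
    using fin f pos by (rule markov_finite_pmf) auto
  also have "\<dots> \<le> (\<rho> ^ T * v) / (\<theta> ^ T * v)" using E pos by (intro divide_right_mono) auto
  also have "\<dots> \<le> ((\<theta> ^ T)\<^sup>2 * v) / (\<theta> ^ T * v)"
    using pos v \<open>\<rho> ^ T \<le> (\<theta> ^ T)\<^sup>2\<close> by (intro divide_right_mono mult_right_mono) auto
  also have "\<dots> = \<theta> ^ T" using False rho(3) by (simp add: power2_eq_square)
  finally show ?thesis .
qed

text \<open>On the logarithmic scale \<open>sqrt \<beta> ^ s\<close> supplies
  \<open>- (1 - q) * D * L / 2\<close>. One eighth of \<open>(1 - q) * D * L\<close> pays for powers
  of \<open>T\<close> and another eighth for powers of 2, which leaves the quarter in the
  claim.\<close>

lemma union_bound_budget: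
  assumes q: "q < 1" and \<beta>: "0 < \<beta>" "\<beta> \<le> exp (- (16 * ln 2 / (1 - q)))" and T: "T > 1"
    and D: "D > 0" "real D \<ge> 48 / (1 - q) * ln (real T) / ln (1 / \<beta>)"
    and s: "real s = (1 - q) * real D" and q0: "0 < q"
  shows "real T * (2 ^ D * (2 * sqrt \<beta>) ^ s) \<le> 1 / real T ^ 5 * exp (- ((1 - q) / 4) * ln (1 / \<beta>) * real D)"
proof -
  define L where "L = ln (1 / \<beta>)"
  have "ln \<beta> \<le> - (16 * ln 2 / (1 - q))" using \<beta> by (metis ln_exp ln_le_cancel_iff exp_gt_zero)
  then have L: "L \<ge> 16 * ln 2 / (1 - q)" using \<beta> by (simp add: L_def ln_div)
  have ln2: "ln 2 > (0::real)" by simp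
  have Lpos: "L > 0" using L q ln2 by (meson divide_pos_pos diff_gt_0_iff_gt less_le_trans mult_pos_pos zero_less_numeral)
  \<comment> \<open>Six logarithms: one for the number of steps and five for the factor
    \<open>1 / T ^ 5\<close>. This fixes the constant \<open>48 = 6 * 8\<close>.\<close>
  have lnT: "6 * ln (real T) \<le> (1 - q) * real D * L / 8"
    using D(2) Lpos q by (simp add: L_def[symmetric] field_simps)
  have "16 * ln 2 * real D \<le> (1 - q) * L * real D"
    using L q by (intro mult_right_mono) (auto simp: field_simps)
  then have D2: "2 * real D * ln 2 \<le> (1 - q) * real D * L / 8" by (simp add: algebra_simps)
  have sq: "2 * sqrt \<beta> = exp (ln 2 - L / 2)"
  proof -
    have "sqrt \<beta> = exp (ln (sqrt \<beta>))" using \<beta> by simp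
    also have "ln (sqrt \<beta>) = - (L / 2)" using \<beta> by (simp add: L_def ln_div ln_sqrt)
    finally have "exp (ln 2) * sqrt \<beta> = exp (ln 2) * exp (- (L / 2))" by simp
    also have "\<dots> = exp (ln 2 - L / 2)" by (simp only: exp_add[symmetric] diff_conv_add_uminus)
    finally show ?thesis by simp
  qed
  have "real T * (2 ^ D * (2 * sqrt \<beta>) ^ s) = exp (ln (real T) + real D * ln 2 + real s * (ln 2 - L / 2))"
    unfolding sq using T by (simp add: exp_add exp_of_nat_mult)
  also have "\<dots> \<le> exp (- 5 * ln (real T) - (1 - q) / 4 * L * real D)"
  proof -
    \<comment> \<open>Together with \<open>2 ^ D\<close> this accounts for the
      \<open>2 * D * ln 2\<close> in \<open>D2\<close>.\<close>
    have "real s * ln 2 \<le> real D * ln 2"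
    proof (rule mult_right_mono)
      have "0 \<le> q * real D" using q0 by simp
      then show "real s \<le> real D" using s by (simp add: algebra_simps)
    qed simp
    moreover have "real s * (ln 2 - L / 2) = real s * ln 2 - (1 - q) * real D * L / 2"
      by (simp add: s field_simps)
    ultimately have "ln (real T) + real D * ln 2 + real s * (ln 2 - L / 2)
        \<le> - 5 * ln (real T) + (6 * ln (real T) + 2 * real D * ln 2 - (1 - q) * real D * L / 2)"
      by simp
    also have "\<dots> \<le> - 5 * ln (real T) + ((1 - q) * real D * L / 8 + (1 - q) * real D * L / 8 - (1 - q) * real D * L / 2)"
      using lnT D2 by linarith
    also have "\<dots> = - 5 * ln (real T) - (1 - q) / 4 * L * real D" by (simp add: field_simps)
    finally show ?thesis by (simp only: exp_le_cancel_iff)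
  qed
  also have "\<dots> = exp (- (5 * ln (real T))) * exp (- ((1 - q) / 4) * L * real D)"
    by (simp flip: exp_add)
  also have "exp (- (5 * ln (real T))) = 1 / real T ^ 5"
    using T exp_of_nat_mult[of 5 "ln (real T)"] by (simp add: exp_minus divide_inverse)
  finally show ?thesis by (simp add: L_def)
qed

text \<open>One fixed instance. The singular value conditions enter as inequalities for sums of
  squares over rows, and \<open>k\<close> is the integer \<open>q * D\<close>.\<close>

locale corrupted_system =
  fixes C q a \<beta> :: real and m n D k :: nat and A :: "real mat" and xs \<epsilon> b :: "real Matrix.vec"
  assumes m: "m > 0" and n: "n > 0" and A: "A \<in> carrier_mat m n"
    and unit_rows: "\<And>r. r < m \<Longrightarrow> euclid_norm (Matrix.row A r) = 1"
    and upper: "\<And>x. x \<in> carrier_vec n \<Longrightarrow>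
      (\<Sum>r<m. (Matrix.row A r \<bullet> x)\<^sup>2) \<le> C\<^sup>2 * real m / real n * (x \<bullet> x)"
    and lower: "\<And>x S. x \<in> carrier_vec n \<Longrightarrow> S \<subseteq> {..<m} \<Longrightarrow> q / 2 * real m \<le> real (card S) \<Longrightarrow>
      a\<^sup>2 * real m / real n * (x \<bullet> x) \<le> (\<Sum>r\<in>S. (Matrix.row A r \<bullet> x)\<^sup>2)"
    and C: "C > 0" and q: "0 < q" "q < 1" and a: "0 \<le> a" "a \<le> 1"
    and \<beta>: "0 < \<beta>" "\<beta> \<le> q / 4" "2 * sqrt \<beta> \<le> 1" "3 * C\<^sup>2 * sqrt (sqrt \<beta>) \<le> a\<^sup>2 / 8"
    and xs: "xs \<in> carrier_vec n" and \<epsilon>: "\<epsilon> \<in> carrier_vec m" and sparse: "sparse_vec (\<beta> * real m) \<epsilon>"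
    and b: "b = A *\<^sub>v xs + \<epsilon>"
    and D: "D > 0" and k: "q * real D = real k"
begin

definition err :: "real Matrix.vec \<Rightarrow> real" where
  "err x = (euclid_norm (x - xs))\<^sup>2"

definition threshold :: "(nat \<Rightarrow> nat) \<Rightarrow> real Matrix.vec \<Rightarrow> real" where
  "threshold i x = quantile q (image_mset (\<lambda>j. \<bar>residual A b x (i j)\<bar>) (mset_set {..<D}))"

text \<open>Depends on the quantile subsample alone, so its indicator factors out of the mean over
  the update index.\<close>

definition moderate :: "(nat \<Rightarrow> nat) \<times> nat \<Rightarrow> real Matrix.vec \<Rightarrow> bool" where
  "moderate d x \<longleftrightarrow> threshold (fst d) x \<le> sqrt (C\<^sup>2 * err x / (sqrt \<beta> * real n))"

abbreviation step_pmf :: "((nat \<Rightarrow> nat) \<times> nat) pmf" where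
  "step_pmf \<equiv> pair_pmf (samples_pmf m D) (pmf_of_set {..<m})"

lemma finite_step_pmf: "finite (set_pmf step_pmf)"
  using m finite_set_samples_pmf by (simp add: lessThan_empty_iff)

lemma row_carrier: "Matrix.row A r \<in> carrier_vec n"
  using A by (simp add: Matrix.row_def)

lemma step_carrier: "x \<in> carrier_vec n \<Longrightarrow> quantileRK_step q D A b d x \<in> carrier_vec n"
  using row_carrier by (cases d) (auto simp: quantileRK_step_def Let_def)

lemma err_nonneg: "err x \<ge> 0"
  by (simp add: err_def)

lemma err_eq: "err x = (x - xs) \<bullet> (x - xs)"
  by (simp add: err_def euclid_norm_power2)

lemma err_step:
  assumes x: "x \<in> carrier_vec n" and r: "r < m"
  shows "err (quantileRK_step q D A b (i, r) x) =
    (if \<bar>residual A b x r\<bar> \<le> threshold i x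
     then err x - 2 * residual A b x r * (Matrix.row A r \<bullet> (x - xs)) + (residual A b x r)\<^sup>2 else err x)"
proof -
  have "Matrix.row A r \<bullet> Matrix.row A r = 1"
    using unit_rows[OF r] by (simp flip: euclid_norm_power2)
  then show ?thesis
    using norm_project[OF x xs row_carrier] by (simp add: quantileRK_step_def Let_def err_eq threshold_def)
qed

text \<open>The corruption is recovered as exact minus observed residual. In this form it makes
  sense for all indices, and inserting it for \<open>\<epsilon>\<close> in the one-step lemmas turns
  their \<open>g r - \<epsilon> r\<close> into \<open>residual\<close>.\<close>

lemma corrupted_rows_card:
  assumes x: "x \<in> carrier_vec n"
  shows "real (card {r. r < m \<and> Matrix.row A r \<bullet> (x - xs) - residual A b x r \<noteq> 0}) \<le> \<beta> * real m"
proof -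
  have "{r. r < m \<and> Matrix.row A r \<bullet> (x - xs) - residual A b x r \<noteq> 0} = {r. r < dim_vec \<epsilon> \<and> \<epsilon> $ r \<noteq> 0}"
    using residual_decompose[OF A xs \<epsilon> x] \<epsilon> by (auto simp: b)
  then show ?thesis using sparse by (simp add: sparse_vec_def)
qed

lemma moderate_failure:
  assumes x: "x \<in> carrier_vec n"
  shows "measure_pmf.prob step_pmf {d. \<not> moderate d x} \<le> 2 ^ D * (2 * sqrt \<beta>) ^ (D - k)"
proof -
  have k': "0 < k" "k \<le> D"
    using quantile_index_bounds[OF q D k] by auto
  have e: "x - xs \<in> carrier_vec n" using x xs by auto
  have "measure_pmf.prob step_pmf {d. \<not> moderate d x} = measure_pmf.prob (map_pmf fst step_pmf)
      {i. \<not> threshold i x \<le> sqrt (C\<^sup>2 * err x / (sqrt \<beta> * real n))}"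
    unfolding measure_map_pmf by (simp add: moderate_def vimage_def)
  also have "map_pmf fst step_pmf = samples_pmf m D" by (rule map_fst_pair_pmf)
  also have "measure_pmf.prob (samples_pmf m D) {i. \<not> threshold i x \<le> sqrt (C\<^sup>2 * err x / (sqrt \<beta> * real n))}
      \<le> 2 ^ D * (2 * sqrt \<beta>) ^ (D - k)"
    using one_step_failure[OF m n C \<beta>(1,3) err_nonneg upper[OF e, folded err_eq] corrupted_rows_card[OF x] D k k']
    by (simp add: threshold_def)
  finally show ?thesis .
qed

lemma step_contraction:
  assumes x: "x \<in> carrier_vec n"
  shows "measure_pmf.expectation step_pmf (\<lambda>d. err (quantileRK_step q D A b d x) * of_bool (moderate d x))
    \<le> (1 - a\<^sup>2 / 8 / real n) * err x"
proof -
  have e: "x - xs \<in> carrier_vec n" using x xs by auto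
  let ?h = "residual A b x"
  let ?g = "\<lambda>r. Matrix.row A r \<bullet> (x - xs)"
  have cancel: "?g r - (?g r - ?h r) = ?h r" for r by simp
  have "measure_pmf.expectation step_pmf (\<lambda>d. err (quantileRK_step q D A b d x) * of_bool (moderate d x)) =
    measure_pmf.expectation (samples_pmf m D) (\<lambda>i.
      measure_pmf.expectation (pmf_of_set {..<m}) (\<lambda>r. err (quantileRK_step q D A b (i, r) x) * of_bool (moderate (i, r) x)))"
    using m by (intro expectation_pair_pmf finite_set_samples_pmf) (auto simp: lessThan_empty_iff)
  also have "\<dots> = measure_pmf.expectation (samples_pmf m D) (\<lambda>i.
      (\<Sum>r<m. if \<bar>?h r\<bar> \<le> threshold i x then err x - 2 * ?h r * ?g r + (?h r)\<^sup>2 else err x) / real m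
        * of_bool (threshold i x \<le> sqrt (C\<^sup>2 * err x / (sqrt \<beta> * real n))))"
    using m x by (simp add: integral_pmf_of_set lessThan_empty_iff moderate_def err_step flip: sum_distrib_right)
  also have "\<dots> \<le> (1 - a\<^sup>2 / 8 / real n) * err x"
    using one_step_contraction[OF m n err_nonneg q a \<beta>(1,2,4) upper[OF e, folded err_eq]
        lower[OF e, folded err_eq] corrupted_rows_card[OF x] D k, unfolded cancel, folded threshold_def]
    by blast
  finally show ?thesis .
qed

lemma rate_nonneg: "0 \<le> 1 - a\<^sup>2 / 8 / real n"
proof -
  have "a\<^sup>2 \<le> 1" using a by (simp add: power_le_one)
  then show ?thesis using n by (simp add: field_simps)
qed

definition failure :: "real Matrix.vec \<Rightarrow> nat \<Rightarrow> (nat \<Rightarrow> (nat \<Rightarrow> nat) \<times> nat) set" where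
  "failure x0 T = {\<omega>. \<exists>j<T. \<not> moderate (\<omega> j) (quantileRK q D A b x0 \<omega> j)}"

lemma draws_pmf_eq: "draws_pmf m D T = Pi_pmf {..<T} undefined (\<lambda>_. step_pmf)"
  by (simp add: draws_pmf_def samples_pmf_def)

lemma finite_draws_pmf: "finite (set_pmf (draws_pmf m D T))"
  unfolding draws_pmf_eq by (intro finite_set_Pi_pmf finite_step_pmf) auto

lemma failure_prob:
  assumes "x0 \<in> carrier_vec n"
  shows "measure_pmf.prob (draws_pmf m D T) (failure x0 T) \<le> real T * (2 ^ D * (2 * sqrt \<beta>) ^ (D - k))"
  unfolding draws_pmf_eq failure_def quantileRK_conv_iterate
  by (rule iterate_failure_prob[where I = "carrier_vec n"])
    (use assms finite_step_pmf step_carrier moderate_failure in auto)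

lemma expected_error:
  assumes "x0 \<in> carrier_vec n"
  shows "measure_pmf.expectation (draws_pmf m D T)
      (\<lambda>\<omega>. err (quantileRK q D A b x0 \<omega> T) * indicator (- failure x0 T) \<omega>)
    \<le> (1 - a\<^sup>2 / 8 / real n) ^ T * err x0"
proof -
  have "indicator (- failure x0 T) \<omega> = (of_bool (\<forall>j<T. moderate (\<omega> j)
      (iterate (quantileRK_step q D A b) x0 \<omega> j)) :: real)" for \<omega>
    by (auto simp: indicator_def failure_def quantileRK_conv_iterate)
  then show ?thesis
    unfolding draws_pmf_eq quantileRK_conv_iterate
    using iterate_expectation_bound[where I = "carrier_vec n" and p = step_pmf and V = err and ok = moderate,
        OF finite_step_pmf assms step_carrier rate_nonneg step_contraction]
    by simp
qed

lemma error_tail: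
  assumes x0: "x0 \<in> carrier_vec n"
  shows "measure_pmf.prob (draws_pmf m D T) {\<omega>. err (quantileRK q D A b x0 \<omega> T) \<le> (1 - a\<^sup>2 / 16 / real n) ^ T * err x0}
    \<ge> 1 - measure_pmf.prob (draws_pmf m D T) (failure x0 T) - exp (- (a\<^sup>2 / 16 * real T / real n))"
proof -
  let ?P = "draws_pmf m D T"
  let ?\<theta> = "1 - a\<^sup>2 / 16 / real n"
  let ?B = "{\<omega>. err (quantileRK q D A b x0 \<omega> T) \<le> ?\<theta> ^ T * err x0}"
  let ?f = "\<lambda>\<omega>. err (quantileRK q D A b x0 \<omega> T) * indicator (- failure x0 T) \<omega>"
  have \<theta>: "0 < ?\<theta>"
  proof -
    have "a\<^sup>2 \<le> 1" using a by (simp add: power_le_one)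
    then show ?thesis using n by (simp add: field_simps)
  qed
  \<comment> \<open>Halving the rate leaves room for Markov's inequality, as
    \<open>1 - 2 * y \<le> (1 - y)\<^sup>2\<close>.\<close>
  have sq: "1 - a\<^sup>2 / 8 / real n \<le> ?\<theta>\<^sup>2"
    using zero_le_power2[of "a\<^sup>2 / 16 / real n"] by (simp add: power2_diff field_simps)
  have "measure_pmf.prob ?P {\<omega>. ?f \<omega> > ?\<theta> ^ T * err x0} \<le> ?\<theta> ^ T"
    by (rule tail_from_expectation[OF finite_draws_pmf _ err_nonneg rate_nonneg sq \<theta> expected_error[OF x0]])
      (simp add: err_nonneg)
  also have "?\<theta> ^ T \<le> exp (- (a\<^sup>2 / 16 / real n)) ^ T"
    using \<theta> exp_ge_add_one_self[of "- (a\<^sup>2 / 16 / real n)"] by (intro power_mono) auto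
  also have "\<dots> = exp (- (a\<^sup>2 / 16 * real T / real n))"
    by (simp flip: exp_of_nat_mult)
  finally have tail: "measure_pmf.prob ?P {\<omega>. ?f \<omega> > ?\<theta> ^ T * err x0} \<le> exp (- (a\<^sup>2 / 16 * real T / real n))" .
  have "measure_pmf.prob ?P (- ?B) \<le> measure_pmf.prob ?P (failure x0 T \<union> {\<omega>. ?f \<omega> > ?\<theta> ^ T * err x0})"
    by (intro measure_pmf.finite_measure_mono) (auto simp: indicator_def)
  also have "\<dots> \<le> measure_pmf.prob ?P (failure x0 T) + measure_pmf.prob ?P {\<omega>. ?f \<omega> > ?\<theta> ^ T * err x0}"
    by (intro measure_Un_le) auto
  finally have "measure_pmf.prob ?P (- ?B) \<le>
    measure_pmf.prob ?P (failure x0 T) + exp (- (a\<^sup>2 / 16 * real T / real n))" using tail by simp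
  moreover have "measure_pmf.prob ?P (- ?B) = 1 - measure_pmf.prob ?P ?B"
    using measure_pmf.prob_compl[of ?B ?P] by (simp add: Compl_eq_Diff_UNIV)
  ultimately show ?thesis by simp
qed

end

section \<open>From the singular value hypotheses to sums over rows\<close>

lemma row_sum_upper:
  assumes A: "A \<in> carrier_mat m n" and mn: "m > 0" "n > 0"
    and s: "sigma_max A * sqrt (real n) / sqrt (real m) \<le> C" and x: "x \<in> carrier_vec n"
  shows "(\<Sum>r<m. (Matrix.row A r \<bullet> x)\<^sup>2) \<le> C\<^sup>2 * real m / real n * (x \<bullet> x)"
proof -
  have "(sigma_max A * sqrt (real n) / sqrt (real m))\<^sup>2 \<le> C\<^sup>2"
    using sigma_max_nonneg[OF A mn(2)] by (intro power_mono s) auto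
  then have le: "(sigma_max A)\<^sup>2 \<le> C\<^sup>2 * real m / real n"
    using mn by (simp add: power_mult_distrib power_divide field_simps)
  have "(\<Sum>r<m. (Matrix.row A r \<bullet> x)\<^sup>2) \<le> (sigma_max A)\<^sup>2 * (x \<bullet> x)"
    using sigma_max_bound[OF A mn(2) x] by (simp only: mult_mat_vec_norm[OF A])
  also have "\<dots> \<le> C\<^sup>2 * real m / real n * (x \<bullet> x)"
    by (intro mult_right_mono le scalar_prod_self_nonneg)
  finally show ?thesis .
qed

text \<open>Full rank makes the row submatrix injective, so its smallest nonzero singular value
  bounds the quadratic form from below on all vectors.\<close>

lemma row_sum_lower:
  assumes A: "A \<in> carrier_mat m n" and mn: "m > 0" "n > 0" and S: "S \<subseteq> {..<m}"
    and s: "a \<le> sigma_min (row_submatrix A S) * sqrt (real n / real m)" and a: "0 \<le> a"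
    and rank: "vec_space.rank (card S) (row_submatrix A S) = n" and x: "x \<in> carrier_vec n"
  shows "a\<^sup>2 * real m / real n * (x \<bullet> x) \<le> (\<Sum>r\<in>S. (Matrix.row A r \<bullet> x)\<^sup>2)"
proof -
  note AS = row_submatrix_carrier[OF A S]
  note smin = sigma_min_bound(2)[OF AS mn(2) x vec_space.full_rank_kernel[OF AS rank]]
  have "a\<^sup>2 \<le> (sigma_min (row_submatrix A S) * sqrt (real n / real m))\<^sup>2"
    using a by (intro power_mono s)
  then have le: "a\<^sup>2 * real m / real n \<le> (sigma_min (row_submatrix A S))\<^sup>2"
    using mn by (simp add: power_mult_distrib power_divide field_simps)
  have "a\<^sup>2 * real m / real n * (x \<bullet> x) \<le> (sigma_min (row_submatrix A S))\<^sup>2 * (x \<bullet> x)"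
    by (intro mult_right_mono le scalar_prod_self_nonneg)
  also have "\<dots> \<le> (\<Sum>r\<in>S. (Matrix.row A r \<bullet> x)\<^sup>2)"
    using smin by (simp only: row_submatrix_norm[OF A S x])
  finally show ?thesis .
qed

theorem theorem3p1:
  fixes C q :: real
  assumes "C > 0" and "0 < q" and "q < 1"
  shows "\<exists>c1 C2 c2 c3 c4 :: real. c1 > 0 \<and> C2 > 0 \<and> c2 > 0 \<and> c3 > 0 \<and> c4 > 0 \<and>
    (\<forall>(m::nat) (n::nat) (A::real mat) (\<beta>::real) (xs::real Matrix.vec) (\<epsilon>::real Matrix.vec)
      (b::real Matrix.vec) (x0::real Matrix.vec) (T::nat) (D::nat).
      m > 0 \<longrightarrow> n > 0 \<longrightarrow>
      A \<in> carrier_mat m n \<longrightarrow>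
      (\<forall>i<m. euclid_norm (Matrix.row A i) = 1) \<longrightarrow>
      (INF S\<in>{S. S \<subseteq> {..<m} \<and> real (card S) \<ge> q / 2 * real m}.
          sigma_min (row_submatrix A S) * sqrt (real n / real m))
        \<ge> sqrt (2 * pi) * (q / 2) powr (3 / 2) / 24 \<longrightarrow>
      (\<forall>S. S \<subseteq> {..<m} \<and> real (card S) \<ge> q / 2 * real m \<longrightarrow>
          vec_space.rank (card S) (row_submatrix A S) = n) \<longrightarrow>
      sigma_max A * sqrt (real n) / sqrt (real m) \<le> C \<longrightarrow>
      (\<forall>q'. 0 < q' \<and> q' < 1 \<longrightarrow>
          sigma_max A * sqrt (real n) / (sqrt (real m) * sqrt (1 - q')) \<le> C / sqrt (1 - q')) \<longrightarrow>
      0 < \<beta> \<longrightarrow> \<beta> < c1 \<longrightarrow>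
      q * real m \<in> \<nat> \<longrightarrow> \<beta> * real m \<in> \<nat> \<longrightarrow> q * real D \<in> \<nat> \<longrightarrow>
      xs \<in> carrier_vec n \<longrightarrow> \<epsilon> \<in> carrier_vec m \<longrightarrow> sparse_vec (\<beta> * real m) \<epsilon> \<longrightarrow>
      b = A *\<^sub>v xs + \<epsilon> \<longrightarrow>
      x0 \<in> carrier_vec n \<longrightarrow>
      T > 1 \<longrightarrow> D > 0 \<longrightarrow> real D \<ge> C2 * ln (real T) / ln (1 / \<beta>) \<longrightarrow>
      (\<exists>\<Omega> :: (nat \<Rightarrow> (nat \<Rightarrow> nat) \<times> nat) set.
          measure_pmf.prob (draws_pmf m D T) \<Omega>
            \<le> 1 / real T ^ 5 * exp (- ((1 - q) / 4) * ln (1 / \<beta>) * real D) \<and>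
          1 / real T ^ 5 * exp (- ((1 - q) / 4) * ln (1 / \<beta>) * real D) \<le> 1 / 2 \<and>
          measure_pmf.expectation (draws_pmf m D T)
              (\<lambda>\<omega>. (euclid_norm (quantileRK q D A b x0 \<omega> T - xs))\<^sup>2 * indicator (- \<Omega>) \<omega>)
            \<le> (1 - c2 / real n) ^ T * (euclid_norm (x0 - xs))\<^sup>2) \<and>
      measure_pmf.prob (draws_pmf m D T)
          {\<omega>. (euclid_norm (quantileRK q D A b x0 \<omega> T - xs))\<^sup>2
                \<le> (1 - c3 / real n) ^ T * (euclid_norm (x0 - xs))\<^sup>2}
        \<ge> 1 - 1 / real T ^ 5 - 2 * exp (- (c4 * real T / real n)))"
proof -
  \<comment> \<open>The lower bound assumed for the scaled smallest singular values; all rates are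
    multiples of its square.\<close>
  define a where "a = sqrt (2 * pi) * (q / 2) powr (3 / 2) / 24"
  have a: "0 < a" "a \<le> 1"
  proof -
    show "0 < a" using assms by (simp add: a_def)
    have "sqrt (2 * pi) \<le> sqrt (24\<^sup>2)" using pi_less_4 by (intro real_sqrt_le_mono) simp
    moreover have "(q / 2) powr (3 / 2) \<le> 1" using assms by (intro powr_le1) auto
    ultimately have "sqrt (2 * pi) * (q / 2) powr (3 / 2) \<le> 24 * 1" by (intro mult_mono) auto
    then show "a \<le> 1" by (simp add: a_def)
  qed
  \<comment> \<open>In order: enough accepted rows stay uncorrupted; the harm
    \<open>3 * C\<^sup>2 * sqrt (sqrt \<beta>)\<close> is at most \<open>a\<^sup>2 / 8\<close>;
    \<open>2 * sqrt \<beta> \<le> 1\<close>; and the powers of 2 in the union bound are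
    absorbed.\<close>
  define c1 where "c1 = Min {q / 4, (a\<^sup>2 / (24 * C\<^sup>2)) ^ 4, 1 / 4, exp (- (16 * ln 2 / (1 - q)))}"
  have c1: "c1 > 0" using assms a by (simp add: c1_def)
  show ?thesis
  \<comment> \<open>The one-step rate is \<open>a\<^sup>2 / 8\<close>; its half serves both as rate
    and as tail exponent in the bound in probability.\<close>
  proof (rule exI[of _ c1], rule exI[of _ "48 / (1 - q)"], rule exI[of _ "a\<^sup>2 / 8"],
      rule exI[of _ "a\<^sup>2 / 16"], rule exI[of _ "a\<^sup>2 / 16"], intro conjI allI impI)
    fix m n :: nat and A :: "real mat" and \<beta> :: real and xs \<epsilon> b x0 :: "real Matrix.vec" and T D :: nat
    assume mn: "m > 0" "n > 0" and A: "A \<in> carrier_mat m n"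
      and rows: "\<forall>i<m. euclid_norm (Matrix.row A i) = 1"
      and inf: "(INF S\<in>{S. S \<subseteq> {..<m} \<and> real (card S) \<ge> q / 2 * real m}.
          sigma_min (row_submatrix A S) * sqrt (real n / real m))
        \<ge> sqrt (2 * pi) * (q / 2) powr (3 / 2) / 24"
      and rank: "\<forall>S. S \<subseteq> {..<m} \<and> real (card S) \<ge> q / 2 * real m \<longrightarrow>
          vec_space.rank (card S) (row_submatrix A S) = n"
      and smax: "sigma_max A * sqrt (real n) / sqrt (real m) \<le> C"
      and \<beta>: "0 < \<beta>" "\<beta> < c1" and qD: "q * real D \<in> \<nat>"
      and xs: "xs \<in> carrier_vec n" and \<epsilon>: "\<epsilon> \<in> carrier_vec m" "sparse_vec (\<beta> * real m) \<epsilon>"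
      and b: "b = A *\<^sub>v xs + \<epsilon>" and x0: "x0 \<in> carrier_vec n"
      and T: "T > 1" and D: "D > 0" "real D \<ge> 48 / (1 - q) * ln (real T) / ln (1 / \<beta>)"
    obtain k where k: "q * real D = real k" using qD by (auto elim: Nats_cases)
    have \<beta>': "\<beta> \<le> q / 4" "\<beta> \<le> (a\<^sup>2 / (24 * C\<^sup>2)) ^ 4" "\<beta> \<le> 1 / 4"
      "\<beta> \<le> exp (- (16 * ln 2 / (1 - q)))"
      using \<beta>(2) by (simp_all add: c1_def)
    have "sqrt \<beta> \<le> sqrt ((1 / 2)\<^sup>2)" using \<beta>'(3) by (intro real_sqrt_le_mono) (simp add: power2_eq_square)
    then have half: "2 * sqrt \<beta> \<le> 1" by simp
    have "sqrt (sqrt \<beta>) \<le> sqrt (sqrt (((a\<^sup>2 / (24 * C\<^sup>2))\<^sup>2)\<^sup>2))"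
      using \<beta>'(2) by (intro real_sqrt_le_mono) (simp flip: power_mult)
    also have "\<dots> = a\<^sup>2 / (24 * C\<^sup>2)" by (simp only: real_sqrt_abs) simp
    finally have small: "3 * C\<^sup>2 * sqrt (sqrt \<beta>) \<le> a\<^sup>2 / 8"
      using assms(1) by (simp add: field_simps)
    interpret rk: corrupted_system C q a \<beta> m n D k A xs \<epsilon> b
    proof
      fix x :: "real Matrix.vec" assume x: "x \<in> carrier_vec n"
      show "(\<Sum>r<m. (Matrix.row A r \<bullet> x)\<^sup>2) \<le> C\<^sup>2 * real m / real n * (x \<bullet> x)"
        by (rule row_sum_upper[OF A mn smax x])
      fix S assume S: "S \<subseteq> {..<m}" "q / 2 * real m \<le> real (card S)"
      \<comment> \<open>Finiteness bounds the family below, so that the real infimum is a lower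
        bound for each member.\<close>
      have "finite {S. S \<subseteq> {..<m} \<and> real (card S) \<ge> q / 2 * real m}"
        by (rule finite_subset[of _ "Pow {..<m}"]) auto
      then have "(INF S\<in>{S. S \<subseteq> {..<m} \<and> real (card S) \<ge> q / 2 * real m}.
          sigma_min (row_submatrix A S) * sqrt (real n / real m))
          \<le> sigma_min (row_submatrix A S) * sqrt (real n / real m)"
        using S by (intro cINF_lower bdd_below_finite finite_imageI) auto
      with inf have "a \<le> sigma_min (row_submatrix A S) * sqrt (real n / real m)"
        unfolding a_def by (rule order_trans)
      then show "a\<^sup>2 * real m / real n * (x \<bullet> x) \<le> (\<Sum>r\<in>S. (Matrix.row A r \<bullet> x)\<^sup>2)"
        using rank S a by (intro row_sum_lower[OF A mn S(1)] x) auto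
    qed (use mn A rows assms a \<beta>(1) \<beta>' half small xs \<epsilon> b D k in auto)
    let ?P = "draws_pmf m D T"
    let ?bound = "1 / real T ^ 5 * exp (- ((1 - q) / 4) * ln (1 / \<beta>) * real D)"
    have "k \<le> D" by (rule quantile_index_bounds(2)[OF assms(2,3) D(1) k])
    then have Dk: "real (D - k) = (1 - q) * real D" by (simp add: of_nat_diff k algebra_simps)
    have fail: "measure_pmf.prob ?P (rk.failure x0 T) \<le> ?bound"
      using rk.failure_prob[OF x0] union_bound_budget[OF assms(3) \<beta>(1) \<beta>'(4) T D Dk assms(2)]
      by (rule order_trans)
    have "0 \<le> ln (1 / \<beta>)" using \<beta>(1) \<beta>'(3) by simp
    then have "exp (- ((1 - q) / 4) * ln (1 / \<beta>) * real D) \<le> 1"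
      using assms by (simp add: mult_nonneg_nonneg)
    then have bound: "?bound \<le> 1 / real T ^ 5"
      using mult_left_mono[of _ 1 "1 / real T ^ 5"] by simp
    \<comment> \<open>Since \<open>T\<close> is an integer above 1, already \<open>1 / T ^ 5\<close>
      is at most 1/2.\<close>
    have "(2::real) ^ 1 \<le> 2 ^ 5" by simp
    also have "(2::real) ^ 5 \<le> real T ^ 5" using T by (intro power_mono) auto
    finally have "1 / real T ^ 5 \<le> 1 / 2" by (intro divide_left_mono) (use T in auto)
    with bound have bound2: "?bound \<le> 1 / 2" by (rule order_trans)
    show "\<exists>\<Omega>. measure_pmf.prob ?P \<Omega> \<le> ?bound \<and> ?bound \<le> 1 / 2 \<and>
        measure_pmf.expectation ?P
            (\<lambda>\<omega>. (euclid_norm (quantileRK q D A b x0 \<omega> T - xs))\<^sup>2 * indicator (- \<Omega>) \<omega>)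
          \<le> (1 - a\<^sup>2 / 8 / real n) ^ T * (euclid_norm (x0 - xs))\<^sup>2"
      using fail bound2 rk.expected_error[OF x0, of T] unfolding rk.err_def by blast
    have "1 - 1 / real T ^ 5 - 2 * exp (- (a\<^sup>2 / 16 * real T / real n))
        \<le> 1 - measure_pmf.prob ?P (rk.failure x0 T) - exp (- (a\<^sup>2 / 16 * real T / real n))"
      using order_trans[OF fail bound] exp_ge_zero[of "- (a\<^sup>2 / 16 * real T / real n)"] by linarith
    also note rk.error_tail[OF x0, of T, unfolded rk.err_def]
    finally show "1 - 1 / real T ^ 5 - 2 * exp (- (a\<^sup>2 / 16 * real T / real n))
      \<le> measure_pmf.prob ?P {\<omega>. (euclid_norm (quantileRK q D A b x0 \<omega> T - xs))\<^sup>2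
                \<le> (1 - a\<^sup>2 / 16 / real n) ^ T * (euclid_norm (x0 - xs))\<^sup>2}" .
  qed (use c1 assms a in auto)
qed

end
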